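(* Let $n\ge 2$, $C>1$ and $K\ge 1$. There exists a constant $M=M(n,C,K)$, depending only on $n,C,K$, such that the following holds. If $D\subsetneq\mathbb{R}^n$ is a domain whose boundary $\partial D$ is a $C$-uniformly perfect set, and if $f\in\mathcal{T}_K(D)$, then $$j_D(x,f(x))\le M\qquad\text{for all }x\in D.$$
   Context: A domain is a non-empty open connected set. The boundary $\partial D$ and closure $\overline D$ of a domain $D\subsetneq\mathbb{R}^n$ are taken in the topology of the Riemann sphere $\widehat{\mathbb{R}^n}=\mathbb{R}^n\cup\{\infty\}$. Quasiconformality: a homeomorphism $f:D\to D'$ between domains of $\mathbb{R}^n$, $n\ge2$, is $K$-quasiconformal ($1\le K<\infty$) if for all $x\in D$ $$\limsup_{r\to0}\frac{\sup\{|f(x)-f(y)|:|x-y|=r\}}{\inf\{|f(x)-f(z)|:|x-z|=r\}}\le K.$$ $\mathcal{T}_K(D)$ is the class of all homeomorphisms $f:\overline D\to\overline D$ such that $f|_D$ is $K$-quasiconformal and $f|_{\partial D}=\mathrm{id}_{\partial D}$. A metric space $X$ is $C$-uniformly perfect ($C>1$) if for each $x\in X$ and every $r>0$, $B(x,r)\setminus B(x,r/C)\ne\emptyset$ provided $X\setminus B(x,r)\neq\emptyset$, where $B(x,r)$ is the open ball. For $D\subsetneq\mathbb{R}^n$, "$\partial D$ is $C$-uniformly perfect" means that $\partial D$ is $C$-uniformly perfect with respect to the spherical metric of $\widehat{\mathbb{R}^n}$. Distance ratio metric: for $x,y\in D$, $$j_D(x,y)=\log\Big(1+\frac{|x-y|}{\min\{d(x),d(y)\}}\Big),$$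 where $d(x)$ is the Euclidean distance from $x$ to the (finite part of the) boundary of $D$. *)

theory Defs
  imports "HOL-Analysis.Analysis"
begin

text \<open>The extended space \<open>\<real>\<^sup>n \<union> {\<infinity>}\<close> is \<open>'a option\<close>: \<open>Some x\<close> is the finite point \<open>x\<close>, and
  \<open>None\<close> is the point at infinity.\<close>

abbreviation riemann_sphere :: "'a::euclidean_space option topology" where
  "riemann_sphere \<equiv> Alexandroff_compactification euclidean"

definition sphere_closure :: "'a::euclidean_space set \<Rightarrow> 'a option set" where
  "sphere_closure D = riemann_sphere closure_of (Some ` D)"

definition sphere_boundary :: "'a::euclidean_space set \<Rightarrow> 'a option set" where
  "sphere_boundary D = riemann_sphere frontier_of (Some ` D)"

text \<open>Inverse stereographic projection onto the unit sphere of \<open>\<real>\<^sup>n \<times> \<real>\<close>, with \<open>\<infinity>\<close> sent to the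
  north pole.  The spherical metric is the chordal distance of the images, see
  \<open>spherical_dist_formula\<close>; it induces the topology of the extended space, see
  \<open>mtopology_spherical\<close>.  Its scaling is immaterial for uniform perfectness.  The great-circle distance is
  \<open>2 * arcsin (spherical_dist p q / 2)\<close>, and a set that is \<open>C\<close>-uniformly perfect for it is
  \<open>C\<close>-uniformly perfect for the chordal distance, since \<open>sin (t / C) \<ge> sin t / C\<close> on
  \<open>[0, pi / 2]\<close>.\<close>

fun stereo :: "'a::euclidean_space option \<Rightarrow> 'a \<times> real" where
  "stereo (Some x) = ((2 / (1 + (norm x)\<^sup>2)) *\<^sub>R x, ((norm x)\<^sup>2 - 1) / (1 + (norm x)\<^sup>2))"
| "stereo None = (0, 1)"

definition spherical_dist :: "'a::euclidean_space option \<Rightarrow> 'a option \<Rightarrow> real" where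
  "spherical_dist p q = dist (stereo p) (stereo q)"

definition uniformly_perfect :: "real \<Rightarrow> 'b set \<Rightarrow> ('b \<Rightarrow> 'b \<Rightarrow> real) \<Rightarrow> bool" where
  "uniformly_perfect C X d \<longleftrightarrow>
     (\<forall>x\<in>X. \<forall>r>0. X - Metric_space.mball X d x r \<noteq> {} \<longrightarrow>
        Metric_space.mball X d x r - Metric_space.mball X d x (r / C) \<noteq> {})"

definition domain :: "'a::euclidean_space set \<Rightarrow> bool" where
  "domain D \<longleftrightarrow> D \<noteq> {} \<and> open D \<and> connected D"

text \<open>For \<open>x\<close> in an open set \<open>D\<close> and small \<open>r\<close> the sphere of radius \<open>r\<close> about \<open>x\<close> lies in \<open>D\<close>, so the
  limit superior does not see the values of \<open>f\<close> outside \<open>D\<close>; on such a sphere a homeomorphism has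
  a finite supremum and a positive infimum of \<open>\<bar>f x - f y\<bar>\<close>.\<close>

definition quasiconformal ::
    "real \<Rightarrow> 'a::euclidean_space set \<Rightarrow> 'a set \<Rightarrow> ('a \<Rightarrow> 'a) \<Rightarrow> bool" where
  "quasiconformal K D D' f \<longleftrightarrow>
     domain D \<and> domain D' \<and> (\<exists>g. homeomorphism D D' f g) \<and>
     (\<forall>x\<in>D. Limsup (at_right 0)
        (\<lambda>r. ereal ((SUP y\<in>sphere x r. norm (f x - f y)) / (INF z\<in>sphere x r. norm (f x - f z))))
        \<le> ereal K)"

text \<open>The map on finite points underlying a map of the extended space; it is meaningful at \<open>x\<close> when
  \<open>f (Some x) \<noteq> \<infinity>\<close>.\<close>

definition finite_part :: "('a option \<Rightarrow> 'a option) \<Rightarrow> 'a \<Rightarrow> 'a" where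
  "finite_part f x = the (f (Some x))"

text \<open>The values of \<open>f\<close> outside the closure of \<open>D\<close> are irrelevant.\<close>

definition qc_identity_boundary ::
    "real \<Rightarrow> 'a::euclidean_space set \<Rightarrow> ('a option \<Rightarrow> 'a option) set" where
  "qc_identity_boundary K D =
     {f. homeomorphic_map (subtopology riemann_sphere (sphere_closure D))
                          (subtopology riemann_sphere (sphere_closure D)) f \<and>
         (\<forall>x\<in>D. f (Some x) \<noteq> None) \<and>
         quasiconformal K D (finite_part f ` D) (finite_part f) \<and>
         (\<forall>p\<in>sphere_boundary D. f p = p)}"

text \<open>\<open>frontier D\<close> is the boundary in \<open>\<real>\<^sup>n\<close>, i.e. the finite part of \<open>sphere_boundary D\<close>; see
  \<open>finite_sphere_boundary\<close> below.\<close>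

definition distance_ratio :: "'a::euclidean_space set \<Rightarrow> 'a \<Rightarrow> 'a \<Rightarrow> real" where
  "distance_ratio D x y =
     ln (1 + norm (x - y) / min (infdist x (frontier D)) (infdist y (frontier D)))"

lemma Some_in_closure_of_iff:
  "Some x \<in> riemann_sphere closure_of T \<longleftrightarrow> x \<in> closure (Some -` T :: 'a::euclidean_space set)"
proof
  assume L: "Some x \<in> riemann_sphere closure_of T"
  show "x \<in> closure (Some -` T)"
    unfolding closure_iff_nhds_not_empty
  proof (intro allI impI)
    fix A U :: "'a set" assume A: "U \<subseteq> A" "open U" "x \<in> U"
    then have "openin riemann_sphere (Some ` U)"
      by (auto simp: openin_Alexandroff_compactification)
    with L A(3) obtain y where "y \<in> T" "y \<in> Some ` U"
      unfolding in_closure_of by blast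
    then show "Some -` T \<inter> A \<noteq> {}" using A(1) by blast
  qed
next
  assume R: "x \<in> closure (Some -` T)"
  show "Some x \<in> riemann_sphere closure_of T"
    unfolding in_closure_of
  proof (intro conjI allI impI)
    show "Some x \<in> topspace riemann_sphere" by simp
    fix V assume V: "Some x \<in> V \<and> openin riemann_sphere V"
    then have "open (Some -` V)"
      unfolding openin_Alexandroff_compactification
      by (auto simp: vimage_def image_iff open_Compl closed_def Compl_eq)
    with V R have "Some -` T \<inter> Some -` V \<noteq> {}"
      unfolding closure_iff_nhds_not_empty by blast
    then show "\<exists>y. y \<in> T \<and> y \<in> V" by blast
  qed
qed

lemma finite_sphere_boundary:
  "{x. Some x \<in> sphere_boundary D} = frontier (D :: 'a::euclidean_space set)"
proof -
  have *: "Some -` Some ` D = D" "Some -` (insert None (range Some) - Some ` D) = - D"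
    by auto
  show ?thesis
    unfolding sphere_boundary_def frontier_of_closures frontier_closures
    by (simp add: Some_in_closure_of_iff * set_eq_iff)
qed

lemma norm_stereo: "norm (stereo p) = 1"
proof (cases p)
  case (Some x)
  define t where "t = (norm x)\<^sup>2"
  have t0: "t \<ge> 0" and t: "1 + t > 0" unfolding t_def by (simp_all add: add_pos_nonneg)
  have "(norm (stereo p))\<^sup>2 = (2 / (1 + t))\<^sup>2 * t + ((t - 1) / (1 + t))\<^sup>2"
    using t0 unfolding Some by (simp add: norm_Pair power_mult_distrib power_divide flip: t_def)
  also have "\<dots> = 1"
    using t by (simp add: divide_simps) (simp add: power2_eq_square algebra_simps)
  finally show ?thesis
    by (simp add: power2_eq_1_iff) (smt (verit) norm_ge_zero)
qed (simp add: norm_prod_def)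

lemma spherical_dist_formula:
  "spherical_dist (Some x) (Some y) =
     2 * norm (x - y) / (sqrt (1 + (norm x)\<^sup>2) * sqrt (1 + (norm y)\<^sup>2))" (is ?A)
  "spherical_dist (Some x) None = 2 / sqrt (1 + (norm x)\<^sup>2)" (is ?B)
proof -
  define a b where "a = (norm x)\<^sup>2" and "b = (norm y)\<^sup>2"
  have a: "1 + a > 0" and b: "1 + b > 0"
    unfolding a_def b_def by (simp_all add: add_pos_nonneg)
  have sq: "(spherical_dist p q)\<^sup>2 = 2 - 2 * (stereo p \<bullet> stereo q)" for p q :: "'a option"
    unfolding spherical_dist_def dist_norm power2_norm_eq_inner
    using norm_stereo[of p] norm_stereo[of q]
    by (simp add: norm_eq_1 inner_diff_left inner_diff_right inner_commute)
  have nn: "spherical_dist p q \<ge> 0" for p q :: "'a option"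
    by (simp add: spherical_dist_def)
  have xy: "(norm (x - y))\<^sup>2 = a + b - 2 * (x \<bullet> y)"
    unfolding a_def b_def power2_norm_eq_inner by (simp add: inner_diff_left inner_diff_right inner_commute)
  have "(spherical_dist (Some x) (Some y))\<^sup>2
      = 2 - 2 * (4 * (x \<bullet> y) / ((1 + a) * (1 + b)) + (a - 1) * (b - 1) / ((1 + a) * (1 + b)))"
    unfolding sq by (simp add: inner_prod_def mult.commute flip: a_def b_def)
  also have "\<dots> = 4 * (a + b - 2 * (x \<bullet> y)) / ((1 + a) * (1 + b))"
    using a b by (simp add: divide_simps) (simp add: algebra_simps)
  also have "\<dots> = (2 * norm (x - y) / (sqrt (1 + a) * sqrt (1 + b)))\<^sup>2"
    using a b by (simp add: power_divide power_mult_distrib xy)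
  finally show ?A
    using a b nn by (simp add: a_def b_def power2_eq_iff_nonneg)
  have "(spherical_dist (Some x) None)\<^sup>2 = 2 - 2 * ((a - 1) / (1 + a))"
    unfolding sq by (simp add: inner_prod_def flip: a_def)
  also have "\<dots> = 4 / (1 + a)"
    using a by (simp add: divide_simps)
  also have "\<dots> = (2 / sqrt (1 + a))\<^sup>2"
    using a by (simp add: power_divide)
  finally show ?B
    using a nn by (simp add: a_def power2_eq_iff_nonneg)
qed

lemma spherical_dist_commute: "spherical_dist p q = spherical_dist q p"
  by (simp add: spherical_dist_def dist_commute)

lemma Metric_space_spherical: "Metric_space UNIV spherical_dist"
proof
  fix p q :: "'a::euclidean_space option"
  have s: "sqrt (1 + (norm (x::'a))\<^sup>2) \<noteq> 0" for x
    by (smt (verit) real_sqrt_eq_zero_cancel_iff zero_le_power2)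
  show "(spherical_dist p q = 0) = (p = q)"
  proof (cases p; cases q)
    fix x y assume "p = Some x" "q = Some y"
    then show ?thesis using s[of x] s[of y] by (simp add: spherical_dist_formula del: real_sqrt_eq_zero_cancel_iff)
  next
    fix x assume "p = Some x" "q = None"
    then show ?thesis using s[of x] by (simp add: spherical_dist_formula del: real_sqrt_eq_zero_cancel_iff)
  next
    fix x assume "p = None" "q = Some x"
    then show ?thesis using s[of x]
      by (simp add: spherical_dist_formula spherical_dist_commute[of None] del: real_sqrt_eq_zero_cancel_iff)
  qed (simp add: spherical_dist_def)
qed (auto simp: spherical_dist_def dist_commute dist_triangle)

lemma mtopology_spherical: "Metric_space.mtopology UNIV spherical_dist = riemann_sphere"
proof -
  interpret Metric_space "UNIV :: 'a::euclidean_space option set" spherical_dist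
    by (rule Metric_space_spherical)
  have 1: "1 + (norm (x::'a))\<^sup>2 > 0" for x
    by (simp add: add_pos_nonneg)
  have cont: "continuous_on UNIV (\<lambda>x::'a. stereo (Some x))"
    using 1 by (auto intro!: continuous_intros simp: less_imp_neq[symmetric])
  have ball: "openin riemann_sphere (mball p r)" for p r
  proof -
    define V where "V = Some -` mball p r"
    have "V = (\<lambda>x. stereo (Some x)) -` ball (stereo p) r"
      by (auto simp: V_def spherical_dist_def)
    then have V: "open V" using open_vimage[OF open_ball cont] by simp
    show ?thesis
    proof (cases "None \<in> mball p r")
      case False
      then have "mball p r = Some ` V"
        unfolding V_def by (auto simp: image_iff) (metis not_None_eq)+
      with V show ?thesis by (auto simp: openin_Alexandroff_compactification)
    next
      case True
      define e where "e = r - spherical_dist p None"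
      have e: "e > 0" using True by (simp add: e_def)
      have "norm x \<le> 2 / e" if "x \<notin> V" for x
      proof (rule ccontr)
        assume "\<not> norm x \<le> 2 / e"
        then have "2 / e < norm x" by simp
        also have "norm x \<le> sqrt (1 + (norm x)\<^sup>2)" by (rule real_le_rsqrt) simp
        finally have "spherical_dist (Some x) None < e"
          using e 1[of x] by (simp add: spherical_dist_formula field_simps)
        moreover have "spherical_dist p (Some x) \<le> spherical_dist p None + spherical_dist None (Some x)"
          by (simp add: triangle)
        ultimately have "Some x \<in> mball p r"
          by (simp add: e_def spherical_dist_commute[of None])
        with that show False by (simp add: V_def)
      qed
      then have "bounded (- V)" by (auto simp: bounded_iff)
      with V have "compact (- V)" by (simp add: compact_eq_bounded_closed closed_Compl)
      moreover have "mball p r = insert None (Some ` (UNIV - (- V)))"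
        using True unfolding V_def by (auto simp: image_iff) (metis not_None_eq)?
      ultimately show ?thesis
        unfolding openin_Alexandroff_compactification
        by (intro disjI2 exI[of _ "- V"]) (auto simp: compact_imp_closed)
    qed
  qed
  have "openin riemann_sphere U" if "openin mtopology U" for U
    unfolding openin_subopen[of _ U]
    using that ball by (metis UNIV_I centre_in_mball_iff openin_mtopology)
  moreover have "topspace riemann_sphere = topspace mtopology"
    by (simp flip: UNIV_option_conv)
  ultimately show ?thesis
    using compact_Hausdorff_space_optimal Hausdorff_space_mtopology
      compact_space_Alexandroff_compactification by metis
qed

end

theory Submission
  imports Defs
begin

text \<open>Extended by the identity, \<open>f\<close> is a homeomorphism \<open>F\<close> of \<open>\<real>\<^sup>n\<close> that fixes the complement of \<open>D\<close>, and
  uniform perfectness gives fixed points at every scale around each boundary point \<open>z\<close>.  The claim then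
  is a distortion estimate for the triples \<open>z\<close>, \<open>x\<close>, \<open>u\<close> with \<open>z\<close> and \<open>u\<close> fixed and \<open>u\<close> as far from
  \<open>z\<close> as \<open>x\<close>, up to constants.

  It follows from a Loewner type inequality in the ring \<open>a / 2 \<le> dist z y \<le> 3 * a\<close>, where
  \<open>v y = dist z' (F y)\<close> takes values \<open>\<le> s\<close> and \<open>\<ge> t\<close> on each of the spheres of radius \<open>\<rho> \<in> {a..2 * a}\<close>.
  Only the compact part \<open>s \<le> v \<le> t\<close> of the ring matters, and in the applications the fixed points of
  the ring are not in it, so that \<open>F\<close> is quasiconformal there.  It is covered by balls \<open>B\<^sub>i\<close> of bounded
  image distortion, with weight \<open>w\<^sub>i\<close> the oscillation of \<open>ln v\<close> on \<open>B\<^sub>i\<close>.  Each path from \<open>v \<le> s\<close> to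
  \<open>v \<ge> t\<close> meets balls of total weight \<open>\<ge> ln (t / s)\<close>; averaging over random two-segment paths bounds
  \<open>ln (t / s)\<close> by the energy \<open>\<Sum>w\<^sub>i\<^sup>n\<close> to the power \<open>1 / n\<close>, up to constants, while volumes in the image
  bound the energy by a multiple of \<open>ln (t / s) + 1\<close>.  As \<open>n \<ge> 2\<close>, this bounds \<open>t / s\<close>.\<close>


subsection \<open>Covering and averaging\<close>

lemma sum_pow_radii_le:
  fixes x :: "'i \<Rightarrow> 'a::euclidean_space"
  assumes "finite I" and r: "\<And>i. i \<in> I \<Longrightarrow> 0 \<le> r i" and "0 \<le> R"
    and disj: "disjoint_family_on (\<lambda>i. ball (x i) (r i)) I"
    and sub: "\<And>i. i \<in> I \<Longrightarrow> ball (x i) (r i) \<subseteq> ball c R"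
  shows "(\<Sum>i\<in>I. r i ^ DIM('a)) \<le> R ^ DIM('a)"
proof -
  define V where "V = unit_ball_vol (DIM('a))"
  have "V * (\<Sum>i\<in>I. r i ^ DIM('a)) = (\<Sum>i\<in>I. measure lborel (ball (x i) (r i)))"
    unfolding sum_distrib_left V_def using r by (intro sum.cong refl) (simp add: content_ball)
  also have "\<dots> = measure lborel (\<Union>i\<in>I. ball (x i) (r i))"
    using assms(1) disj
    by (intro measure_finite_Union[symmetric]) (auto simp: emeasure_ball r)
  also have "\<dots> \<le> measure lborel (ball c R)"
    using sub 
    by (intro measure_mono_fmeasurable) (auto intro!: sets.finite_UN assms(1) fmeasurableI emeasure_lborel_ball_finite)
  also have "\<dots> = V * R ^ DIM('a)"
    using \<open>0 \<le> R\<close> by (simp add: content_ball V_def)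
  finally show ?thesis
    by (simp add: V_def)
qed

text \<open>The hit condition is integrated over \<open>B\<close>. In the application
  \<open>X\<close> is the random corner of a two-segment path, and \<open>G i\<close> contains the
  corners whose path meets the \<open>i\<close>-th ball.\<close>

lemma average_weighted_hits:
  fixes B :: "'a::euclidean_space set" and w :: "'i \<Rightarrow> real"
  assumes "finite I" and "\<And>i. i \<in> I \<Longrightarrow> 0 \<le> w i"
    and B: "B \<in> fmeasurable lborel" and G: "\<And>i. i \<in> I \<Longrightarrow> G i \<in> fmeasurable lborel"
    and hit: "\<And>X. X \<in> B \<Longrightarrow> T \<le> (\<Sum>i\<in>I. w i * indicator (G i) X)"
  shows "T * measure lborel B \<le> (\<Sum>i\<in>I. w i * measure lborel (G i))"
proof -
  have int: "integrable lborel (indicator (G i) :: 'a \<Rightarrow> real)" if "i \<in> I" for i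
    using G[OF that] by (simp add: fmeasurable_def integrable_indicator_iff)
  have intB: "integrable lborel (indicator B :: 'a \<Rightarrow> real)"
    using B by (simp add: fmeasurable_def integrable_indicator_iff)
  have "T * measure lborel B = (\<integral>X. T * indicator B X \<partial>lborel)"
    using B by (simp add: fmeasurable_def)
  also have "\<dots> \<le> (\<integral>X. (\<Sum>i\<in>I. w i * indicator (G i) X) \<partial>lborel)"
  proof (rule integral_mono)
    show "integrable lborel (\<lambda>X. T * indicator B X)" using intB by simp
    show "integrable lborel (\<lambda>X. \<Sum>i\<in>I. w i * indicator (G i) X)"
      using int by (intro Bochner_Integration.integrable_sum) simp
    fix X
    have "0 \<le> (\<Sum>i\<in>I. w i * indicator (G i) X)"
      by (intro sum_nonneg mult_nonneg_nonneg assms(2)) auto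
    then show "T * indicator B X \<le> (\<Sum>i\<in>I. w i * indicator (G i) X)"
      using hit[of X] by (cases "X \<in> B") auto
  qed
  also have "\<dots> = (\<Sum>i\<in>I. w i * measure lborel (G i))"
    using int G by (subst Bochner_Integration.integral_sum) (auto simp: fmeasurable_def)
  finally show ?thesis .
qed

text \<open>Within distance \<open>m\<close> of \<open>p\<close>, the shadow of
  \<open>ball x \<rho>\<close> seen from \<open>p\<close> stays close to the ray from
  \<open>p\<close> through \<open>x\<close>. About \<open>dist x p / \<rho>\<close> balls along this
  ray, of radius comparable to \<open>m * \<rho> / dist x p\<close>, cover it, which gives the
  exponent \<open>DIM('a) - 1\<close>.\<close>

lemma measure_shadow_le:
  fixes p x :: "'a::euclidean_space"
  assumes \<rho>: "0 < \<rho>" "2 * \<rho> < dist x p" and m: "0 < m"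
  obtains G where "G \<in> fmeasurable lborel"
    "\<And>X. dist X p \<le> m \<Longrightarrow> closed_segment p X \<inter> ball x \<rho> \<noteq> {} \<Longrightarrow> X \<in> G"
    "measure lborel G \<le> 2 * unit_ball_vol (DIM('a)) * (4 * m) ^ DIM('a) * (\<rho> / dist x p) ^ (DIM('a) - 1)"
proof -
  define d where "d = dist x p"
  \<comment> \<open>A hit at parameter \<open>u\<close> has distance at least \<open>d / 2\<close>
    and at most \<open>u * m\<close> from \<open>p\<close>, so the factor \<open>1 / u\<close> that
    stretches it to \<open>X\<close> is at most \<open>2 * m / d\<close>.\<close>
  define \<Lambda> where "\<Lambda> = 2 * m / d"
  define N where "N = nat \<lceil>d / \<rho>\<rceil>"
  define V where "V = unit_ball_vol (DIM('a))"
  have d: "d > 0" "2 * \<rho> < d" using \<rho> by (auto simp: d_def)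
  have L: "\<Lambda> > 0" using d m by (simp add: \<Lambda>_def)
  have N: "d / \<rho> \<le> N" "N \<le> d / \<rho> + 1" "N > 0"
    using d \<rho> by (auto simp: N_def)
  define G where "G = (\<Union>j\<in>{0..N}. cball (p + (\<Lambda> * j / N) *\<^sub>R (x - p)) (2 * \<Lambda> * \<rho>))"
  have "G \<in> fmeasurable lborel"
    unfolding G_def by (intro fmeasurable.finite_UN) (auto intro: fmeasurable_compact)
  moreover have "X \<in> G" if X: "dist X p \<le> m" and hit: "closed_segment p X \<inter> ball x \<rho> \<noteq> {}" for X
  proof -
    obtain u where u: "0 \<le> u" "u \<le> 1" and y: "p + u *\<^sub>R (X - p) \<in> ball x \<rho>"
    proof -
      obtain y' where "y' \<in> ball x \<rho>" "y' \<in> closed_segment p X"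
        using hit by blast
      moreover from this(2) obtain u where "0 \<le> u" "u \<le> 1" "y' = (1 - u) *\<^sub>R p + u *\<^sub>R X"
        unfolding in_segment by blast
      moreover have "(1 - u) *\<^sub>R p + u *\<^sub>R X = p + u *\<^sub>R (X - p)" by (simp add: algebra_simps)
      ultimately show ?thesis using that[of u] by simp
    qed
    define y where "y = p + u *\<^sub>R (X - p)"
    have yx: "norm (y - x) < \<rho>" using y by (simp add: y_def dist_norm norm_minus_commute)
    have yp: "norm (y - p) \<ge> d / 2"
      using yx d norm_triangle_ineq4[of "x - y" "p - y"] by (simp add: d_def dist_norm norm_minus_commute)
    have nyp: "norm (y - p) = u * norm (X - p)" using u by (simp add: y_def)
    have u0: "u > 0" using yp nyp d u by (cases "u = 0") auto
    have "d / 2 \<le> u * m"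
      using yp nyp X u mult_left_mono[of "norm (X - p)" m u] by (simp add: dist_norm)
    then have lam: "1 / u \<le> \<Lambda>"
      using d u0 by (simp add: \<Lambda>_def field_simps)
    define j where "j = nat \<lceil>(1 / u) * N / \<Lambda>\<rceil>"
    have "(1 / u) * N / \<Lambda> \<le> N" 
      using mult_right_mono[OF lam, of "real N / \<Lambda>"] L N by simp
    then have jN: "j \<le> N" unfolding j_def by linarith
    have "\<bar>(1 / u) * N / \<Lambda> - j\<bar> \<le> 1"
      unfolding j_def using u0 L by simp linarith
    from mult_right_mono[OF this, of "\<Lambda> / N"]
    have "\<bar>(1 / u) * N / \<Lambda> - j\<bar> * (\<Lambda> / N) \<le> \<Lambda> / N"
      using L by simp
    moreover have "\<bar>(1 / u) * N / \<Lambda> - j\<bar> * (\<Lambda> / N) = \<bar>1 / u - \<Lambda> * j / N\<bar>"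
    proof -
      have "\<bar>(1 / u) * N / \<Lambda> - j\<bar> * (\<Lambda> / N) = \<bar>((1 / u) * N / \<Lambda> - j) * (\<Lambda> / N)\<bar>"
        using L N by (simp add: abs_mult)
      also have "((1 / u) * N / \<Lambda> - j) * (\<Lambda> / N) = 1 / u - \<Lambda> * j / N"
        using L N u0 by (simp add: field_simps)
      finally show ?thesis .
    qed
    ultimately have j: "\<bar>1 / u - \<Lambda> * j / N\<bar> \<le> \<Lambda> / N" by simp
    have NL: "\<Lambda> / N * d \<le> \<Lambda> * \<rho>"
      using N d \<rho> L by (simp add: field_simps)
    \<comment> \<open>The first summand is the deviation of the hit from \<open>x\<close>, stretched
      by \<open>1 / u\<close>; the second is the error of rounding \<open>1 / u\<close> to a grid of
      \<open>N\<close> steps.\<close>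
    have "X - (p + (\<Lambda> * j / N) *\<^sub>R (x - p)) = (1 / u) *\<^sub>R (y - x) + (1 / u - \<Lambda> * j / N) *\<^sub>R (x - p)"
      using u0 by (simp add: y_def algebra_simps scaleR_add_right scaleR_diff_right)
    also have "norm \<dots> \<le> (1 / u) * norm (y - x) + \<bar>1 / u - \<Lambda> * j / N\<bar> * norm (x - p)"
      using u0 by (intro order.trans[OF norm_triangle_ineq]) simp
    also have "\<dots> \<le> \<Lambda> * \<rho> + \<Lambda> / N * d"
      using lam yx j d u0 L unfolding d_def dist_norm by (intro add_mono mult_mono) auto
    also have "\<dots> \<le> 2 * \<Lambda> * \<rho>" using NL by simp
    finally show ?thesis
      unfolding G_def using jN by (auto simp: dist_norm norm_minus_commute intro!: bexI[of _ j])
  qed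
  moreover have "measure lborel G \<le> 2 * V * (4 * m) ^ DIM('a) * (\<rho> / d) ^ (DIM('a) - 1)"
  proof -
    obtain k where k: "DIM('a) = Suc k" using DIM_positive[where 'a='a] by (metis gr0_implies_Suc)
    have "measure lborel G \<le> (\<Sum>j\<in>{0..N}. measure lborel (cball (p + (\<Lambda> * j / N) *\<^sub>R (x - p)) (2 * \<Lambda> * \<rho>)))"
      unfolding G_def by (rule measure_UNION_le) auto
    also have "\<dots> = (N + 1) * (V * (2 * \<Lambda> * \<rho>) ^ DIM('a))"
      using L \<rho> by (simp add: content_cball V_def)
    also have "\<dots> \<le> (2 * d / \<rho>) * (V * (2 * \<Lambda> * \<rho>) ^ DIM('a))"
    proof (rule mult_right_mono)
      have "2 \<le> d / \<rho>" using d \<rho> by (simp add: field_simps)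
      then show "real (N + 1) \<le> 2 * d / \<rho>" using N by simp
    qed (use L \<rho> in \<open>simp add: V_def\<close>)
    also have "\<dots> = 2 * V * (d / \<rho>) * (4 * m * (\<rho> / d)) ^ Suc k"
      by (simp add: \<Lambda>_def k mult_ac)
    also have "\<dots> = 2 * V * (4 * m) ^ Suc k * (\<rho> / d) ^ k"
      unfolding power_mult_distrib using d \<rho> by (simp add: field_simps)
    finally show ?thesis by (simp add: k)
  qed
  ultimately show ?thesis using that by (simp add: d_def V_def)
qed

text \<open>By connectedness \<open>ln v\<close> takes every value between \<open>ln s\<close> and
  \<open>ln t\<close> on \<open>P\<close>, so the intervals \<open>?U i\<close> cover
  \<open>{ln s..ln t}\<close> and their lengths add up to at least \<open>ln (t / s)\<close>. The
  bound \<open>R i \<le> D i / 4\<close> keeps each length below a multiple of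
  \<open>R i / D i\<close>.\<close>

lemma ln_ratio_le_sum:
  fixes v :: "'a::topological_space \<Rightarrow> real"
  assumes P: "connected P" "continuous_on P v" and p: "p \<in> P" "v p \<le> s" and q: "q \<in> P" "t \<le> v q"
    and s: "0 < s" "s \<le> t" and J: "finite J"
    and R: "\<And>i. i \<in> J \<Longrightarrow> 0 \<le> R i \<and> R i \<le> D i / 4 \<and> 0 < D i"
    and cov: "\<And>y. y \<in> P \<Longrightarrow> s \<le> v y \<Longrightarrow> v y \<le> t \<Longrightarrow> \<exists>i\<in>J. \<bar>v y - D i\<bar> \<le> R i"
  shows "ln (t / s) \<le> (\<Sum>i\<in>J. 3 * R i / D i)"
proof -
  let ?U = "\<lambda>i. {ln (D i - R i)..ln (D i + R i)}"
  have pos: "0 < D i - R i" if "i \<in> J" for i using R[OF that] by auto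
  have le_exp: "ln z \<le> l \<longleftrightarrow> z \<le> exp l" if "0 < z" for z l :: real
    using that by (metis exp_le_cancel_iff exp_ln)
  have sub: "{ln s..ln t} \<subseteq> (\<Union>i\<in>J. ?U i)"
  proof
    fix l assume l: "l \<in> {ln s..ln t}"
    then have e: "s \<le> exp l" "exp l \<le> t"
      using s by (auto simp: le_exp ln_ge_iff)
    have "connected (v ` P)" using P by (rule connected_continuous_image[rotated])
    then have "exp l \<in> v ` P"
      using p q e unfolding connected_iff_interval by (meson imageI order_trans)
    then obtain y where y: "y \<in> P" "v y = exp l" by auto
    then obtain i where i: "i \<in> J" "\<bar>exp l - D i\<bar> \<le> R i" using cov e by metis
    then have "l \<in> ?U i" using pos[of i] R[of i] by (auto simp: le_exp ln_ge_iff)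
    then show "l \<in> (\<Union>i\<in>J. ?U i)" using i by auto
  qed
  have "ln (t / s) = measure lborel {ln s..ln t}"
    using s by (simp add: ln_div)
  also have "\<dots> \<le> measure lborel (\<Union>i\<in>J. ?U i)"
    using sub J by (intro measure_mono_fmeasurable fmeasurable.finite_UN) (auto intro: fmeasurable_compact)
  also have "\<dots> \<le> (\<Sum>i\<in>J. measure lborel (?U i))"
    using J by (intro measure_UNION_le) auto
  also have "\<dots> \<le> (\<Sum>i\<in>J. 3 * R i / D i)"
  proof (rule sum_mono)
    fix i assume i: "i \<in> J"
    have "measure lborel (?U i) = ln ((D i + R i) / (D i - R i))"
      using R[OF i] pos[OF i] by (simp add: ln_div)
    also have "\<dots> \<le> (D i + R i) / (D i - R i) - 1"
      using R[OF i] pos[OF i] by (intro ln_le_minus_one) auto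
    also have "\<dots> \<le> 3 * R i / D i"
    proof -
      have "R i * (3 * R i) \<le> R i * D i" using R[OF i] by (intro mult_left_mono) auto
      then show ?thesis
        using R[OF i] pos[OF i] by (simp add: field_simps)
    qed
    finally show "measure lborel (?U i) \<le> 3 * R i / D i" .
  qed
  finally show ?thesis .
qed


section \<open>Good base points and summation over scales\<close>

text \<open>A weak type estimate for a maximal function of the radius. If every
  \<open>\<rho>\<close> had a bad scale, a disjoint Vitali subfamily of the intervals of bad scale
  would carry more than the total mass. The constant \<open>10\<close> is the Vitali factor
  \<open>5\<close> times the factor \<open>2\<close> between radius and length of an
  interval.\<close>

lemma exists_good_radius:
  fixes x :: "'i \<Rightarrow> 'a::euclidean_space" and p :: "real \<Rightarrow> 'a"
  assumes "finite I" and w: "\<And>i. i \<in> I \<Longrightarrow> 0 \<le> w i" and "0 < a"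
    and p: "\<And>\<rho>. \<rho> \<in> {a..2 * a} \<Longrightarrow> dist z (p \<rho>) = \<rho>"
  obtains \<rho> where "\<rho> \<in> {a..2 * a}"
    "\<And>r. 0 < r \<Longrightarrow> (\<Sum>i | i \<in> I \<and> dist (x i) (p \<rho>) \<le> r. w i) \<le> 10 * r / a * (\<Sum>i\<in>I. w i)"
proof (rule ccontr)
  define E where "E = (\<Sum>i\<in>I. w i)"
  define S where "S \<rho> r = (\<Sum>i | i \<in> I \<and> dist (x i) (p \<rho>) \<le> r. w i)" for \<rho> r
  assume "\<not> thesis"
  with that have "\<forall>\<rho>\<in>{a..2 * a}. \<exists>r>0. 10 * r / a * E < S \<rho> r"
    unfolding E_def S_def by (meson not_le)
  then obtain R where R: "\<And>\<rho>. \<rho> \<in> {a..2 * a} \<Longrightarrow> 0 < R \<rho>"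
    "\<And>\<rho>. \<rho> \<in> {a..2 * a} \<Longrightarrow> 10 * R \<rho> / a * E < S \<rho> (R \<rho>)"
    by metis
  have E0: "E \<ge> 0" unfolding E_def by (rule sum_nonneg) (rule w)
  have SE: "S \<rho> r \<le> E" for \<rho> r
    unfolding S_def E_def using assms(1) w by (intro sum_mono2) auto
  have Ra: "R \<rho> \<le> a" if "\<rho> \<in> {a..2 * a}" for \<rho>
  proof (rule ccontr)
    assume "\<not> R \<rho> \<le> a"
    then have "1 \<le> 10 * R \<rho> / a" using \<open>0 < a\<close> by simp
    then have "1 * E \<le> 10 * R \<rho> / a * E" using E0 by (intro mult_right_mono) auto
    then show False using R(2)[OF that] SE[of \<rho> "R \<rho>"] by simp
  qed
  obtain C where C: "countable C" "C \<subseteq> {a..2 * a}"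
    "pairwise (\<lambda>i j. disjnt (cball i (R i)) (cball j (R j))) C"
    "\<And>i. i \<in> {a..2 * a} \<Longrightarrow> \<exists>j. j \<in> C \<and> \<not> disjnt (cball i (R i)) (cball j (R j)) \<and>
          cball i (R i) \<subseteq> ball j (5 * R j)"
  proof (rule Vitali_covering_lemma_cballs_balls[of "{a..2 * a}" R a "\<lambda>\<rho>. \<rho>"])
    show "0 < R i \<and> R i \<le> a" if "i \<in> {a..2 * a}" for i using that R(1) Ra by simp
  qed (rule that)
  have "{a..2 * a} \<subseteq> (\<Union>j\<in>C. ball j (5 * R j))"
  proof
    fix i assume i: "i \<in> {a..2 * a}"
    then have "i \<in> cball i (R i)" using R(1)[OF i] by simp
    then show "i \<in> (\<Union>j\<in>C. ball j (5 * R j))" using C(4)[OF i] by blast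
  qed
  then obtain C' where C': "C' \<subseteq> C" "finite C'" "{a..2 * a} \<subseteq> (\<Union>j\<in>C'. ball j (5 * R j))"
    by (rule compactE_image[OF compact_Icc, rotated]) auto
  have RC: "j \<in> {a..2 * a}" "0 < R j" if "j \<in> C'" for j
    using that C' C R by auto
  have "a = measure lborel {a..2 * a}" using \<open>0 < a\<close> by simp
  also have "\<dots> \<le> measure lborel (\<Union>j\<in>C'. ball j (5 * R j))"
    using C' by (intro measure_mono_fmeasurable fmeasurable.finite_UN)
      (auto intro!: fmeasurableI emeasure_lborel_ball_finite)
  also have "\<dots> \<le> (\<Sum>j\<in>C'. measure lborel (ball j (5 * R j)))"
    using C' by (intro measure_UNION_le) auto
  also have "\<dots> = (\<Sum>j\<in>C'. 10 * R j)"
    using RC by (intro sum.cong refl) (simp add: content_ball less_imp_le)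
  finally have big: "a \<le> (\<Sum>j\<in>C'. 10 * R j)" .
  have "C' \<noteq> {}" using C'(3) \<open>0 < a\<close> by auto
  have "(\<Sum>j\<in>C'. 10 * R j / a * E) < (\<Sum>j\<in>C'. S j (R j))"
    using \<open>C' \<noteq> {}\<close> C'(2) R RC by (intro sum_strict_mono) auto
  also have "\<dots> = (\<Sum>i\<in>(\<Union>j\<in>C'. {i \<in> I. dist (x i) (p j) \<le> R j}). w i)"
    unfolding S_def
  proof (rule sum.UNION_disjoint[symmetric])
    show "\<forall>j\<in>C'. \<forall>k\<in>C'. j \<noteq> k \<longrightarrow>
      {i \<in> I. dist (x i) (p j) \<le> R j} \<inter> {i \<in> I. dist (x i) (p k) \<le> R k} = {}"
    proof (intro ballI impI, rule ccontr)
      fix j k assume jk: "j \<in> C'" "k \<in> C'" "j \<noteq> k"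
        and "{i \<in> I. dist (x i) (p j) \<le> R j} \<inter> {i \<in> I. dist (x i) (p k) \<le> R k} \<noteq> {}"
      then obtain i where i: "dist (x i) (p j) \<le> R j" "dist (x i) (p k) \<le> R k" by auto
      \<comment> \<open>The map \<open>dist z\<close> sends \<open>p j\<close> to \<open>j\<close>
        and does not increase distances, so a common index would put \<open>dist z (x i)\<close>
        into two disjoint intervals.\<close>
      have "dist (dist z (x i)) j \<le> R j" "dist (dist z (x i)) k \<le> R k"
        using i p[OF RC(1)[OF jk(1)]] p[OF RC(1)[OF jk(2)]]
          abs_dist_diff_le[of "x i" z "p j"] abs_dist_diff_le[of "x i" z "p k"]
        by (auto simp: dist_real_def dist_commute)
      then have "dist z (x i) \<in> cball j (R j) \<inter> cball k (R k)"
        by (simp add: dist_commute)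
      then show False
        using C(3) C'(1) jk unfolding pairwise_def disjnt_def by blast
    qed
  qed (use C' assms in auto)
  also have "\<dots> \<le> E"
    unfolding E_def using assms(1) w by (intro sum_mono2) auto
  also have "E \<le> (\<Sum>j\<in>C'. 10 * R j) / a * E"
    using big E0 \<open>0 < a\<close> mult_right_mono[of 1 "(\<Sum>j\<in>C'. 10 * R j) / a" E] by simp
  also have "\<dots> = (\<Sum>j\<in>C'. 10 * R j / a * E)"
    by (simp add: sum_divide_distrib sum_distrib_right)
  finally show False by simp
qed

text \<open>A crude form of Young's inequality with a free parameter \<open>l\<close>: the first or
  the second term on the right dominates according as \<open>w \<le> l * x\<close> or not.\<close>

lemma mult_power_le_add:
  fixes w x l :: real
  assumes "0 \<le> w" "0 \<le> x" "0 < l"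
  shows "w * x ^ n \<le> l * x ^ Suc n + w ^ Suc n / l ^ n"
proof (cases "w \<le> l * x")
  case True
  then have "w * x ^ n \<le> l * x * x ^ n" using assms by (intro mult_right_mono) auto
  moreover have "0 \<le> w ^ Suc n / l ^ n" using assms by simp
  ultimately show ?thesis by (simp add: mult_ac)
next
  case False
  then have "x ^ n \<le> (w / l) ^ n" using assms by (intro power_mono) (auto simp: field_simps)
  then have "w * x ^ n \<le> w * (w / l) ^ n" using assms by (intro mult_left_mono) auto
  moreover have "0 \<le> l * x ^ Suc n" using assms by simp
  ultimately show ?thesis by (simp add: power_divide)
qed

lemma exists_scale:
  fixes b h H :: real
  assumes "1 < b" "0 < h" "h \<le> H"
  obtains k :: nat where "h \<le> H / b ^ k" "H / b ^ Suc k < h"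
proof -
  obtain n where n: "H / h < b ^ n" using real_arch_pow[OF \<open>1 < b\<close>] by blast
  define P where "P n = (H / b ^ n < h)" for n :: nat
  have "P n" using n assms unfolding P_def by (simp add: field_simps)
  moreover have "\<not> P 0" using assms by (simp add: P_def)
  ultimately obtain k where "\<not> P k" "P (Suc k)"
    using ex_least_nat_less[of P n] by blast
  then show ?thesis using that[of k] by (simp add: P_def)
qed

text \<open>The scale \<open>max (dist (x i) p) (r i)\<close> is split by powers of \<open>2 ^ n\<close> with \<open>n = DIM('a)\<close>,
  and \<open>mult_power_le_add\<close> is used with the parameter \<open>\<Lambda> / 2 ^ k\<close> on the \<open>k\<close>-th scale, so that both
  resulting sums are geometric with ratio \<open>1 / 2\<close>.\<close>

lemma sum_hitting_weights_le:
  fixes x :: "'i \<Rightarrow> 'a::euclidean_space" and p :: 'a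
  defines "h \<equiv> \<lambda>i r. max (dist (x i) p) r"
  assumes "finite I" and r: "\<And>i. i \<in> I \<Longrightarrow> 0 < r i"
    and disj: "disjoint_family_on (\<lambda>i. ball (x i) (r i)) I"
    and w: "\<And>i. i \<in> I \<Longrightarrow> 0 \<le> w i" and H: "\<And>i. i \<in> I \<Longrightarrow> h i (r i) \<le> H"
    and good: "\<And>s. 0 < s \<Longrightarrow> (\<Sum>i | i \<in> I \<and> dist (x i) p \<le> s. w i ^ DIM('a)) \<le> B * s"
    and L: "0 < \<Lambda>" and "0 < H"
  shows "(\<Sum>i\<in>I. w i * (r i / h i (r i)) ^ (DIM('a) - 1))
     \<le> 2 * (\<Lambda> * (2 * 2 ^ DIM('a)) ^ DIM('a) + B * H / \<Lambda> ^ (DIM('a) - 1))"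
proof -
  define n where "n = DIM('a) - 1"
  have n: "DIM('a) = Suc n" using DIM_positive[where 'a='a] by (simp add: n_def)
  define b :: real where "b = 2 ^ Suc n"
  define g where "g i = h i (r i)" for i
  have b1: "1 < b" unfolding b_def by (rule one_less_power) auto
  have g0: "0 < g i" if "i \<in> I" for i using r[OF that] by (auto simp: g_def h_def)
  have "\<exists>k. g i \<le> H / b ^ k \<and> H / b ^ Suc k < g i" if "i \<in> I" for i
    using exists_scale[OF b1 g0[OF that] H[OF that, folded g_def]] by metis
  then obtain k where k: "\<And>i. i \<in> I \<Longrightarrow> g i \<le> H / b ^ k i" "\<And>i. i \<in> I \<Longrightarrow> H / b ^ Suc (k i) < g i"
    by metis
  obtain N where N: "\<And>i. i \<in> I \<Longrightarrow> k i < N"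
    using finite_nat_set_iff_bounded[of "k ` I"] \<open>finite I\<close> by auto
  define A where "A = \<Lambda> * (2 * b) ^ Suc n + B * H / \<Lambda> ^ n"
  have level: "(\<Sum>i | i \<in> I \<and> k i = m. w i * (r i / g i) ^ n) \<le> A * (1 / 2) ^ m" for m
  proof -
    define l where "l = \<Lambda> / 2 ^ m"
    have l: "0 < l" using L by (simp add: l_def)
    let ?J = "{i \<in> I. k i = m}"
    have gm: "g i \<le> H / b ^ m" "H / b ^ Suc m < g i" if "i \<in> ?J" for i using that k by auto
    have bm: "0 < H / b ^ m" using b1 \<open>0 < H\<close> by simp
    have "(\<Sum>i\<in>?J. w i * (r i / g i) ^ n) \<le> (\<Sum>i\<in>?J. l * (r i / g i) ^ Suc n + w i ^ Suc n / l ^ n)"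
      using w r g0 l by (intro sum_mono mult_power_le_add) (auto intro!: divide_nonneg_pos less_imp_le)
    also have "\<dots> = l * (\<Sum>i\<in>?J. (r i / g i) ^ Suc n) + (\<Sum>i\<in>?J. w i ^ Suc n) / l ^ n"
      by (simp add: sum.distrib sum_distrib_left sum_divide_distrib)
    also have "\<dots> \<le> l * (2 * b) ^ Suc n + (B * (H / b ^ m)) / l ^ n"
    proof (intro add_mono mult_left_mono divide_right_mono)
      have "(\<Sum>i\<in>?J. (r i / g i) ^ Suc n) \<le> (\<Sum>i\<in>?J. (r i / (H / b ^ Suc m)) ^ Suc n)"
      proof (intro sum_mono power_mono divide_left_mono)
        fix i assume "i \<in> ?J"
        then show "H / b ^ Suc m \<le> g i" "0 \<le> r i" "0 \<le> r i / g i" "0 < g i * (H / b ^ Suc m)"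
          using gm[of i] r[of i] g0[of i] b1 \<open>0 < H\<close> by (auto intro!: divide_nonneg_pos)
      qed
      also have "\<dots> = (\<Sum>i\<in>?J. r i ^ Suc n) / (H / b ^ Suc m) ^ Suc n"
        by (simp only: power_divide[of "r _"] sum_divide_distrib)
      also have "\<dots> \<le> (2 * (H / b ^ m)) ^ Suc n / (H / b ^ Suc m) ^ Suc n"
      proof (rule divide_right_mono)
        \<comment> \<open>The disjoint balls of one level lie in a ball of comparable scale, so
          volumes bound this sum independently of the level.\<close>
        have "ball (x i) (r i) \<subseteq> ball p (2 * (H / b ^ m))" if "i \<in> ?J" for i
        proof
          fix y assume "y \<in> ball (x i) (r i)"
          then have "dist p y < dist p (x i) + r i"
            using dist_triangle[of p y "x i"] by simp
          also have "\<dots> \<le> 2 * g i" by (auto simp: g_def h_def dist_commute)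
          finally show "y \<in> ball p (2 * (H / b ^ m))" using gm[OF that] by simp
        qed
        then show "(\<Sum>i\<in>?J. r i ^ Suc n) \<le> (2 * (H / b ^ m)) ^ Suc n"
          unfolding n[symmetric] using \<open>finite I\<close> r bm disj
          by (intro sum_pow_radii_le disjoint_family_on_mono[of ?J I]) (auto simp: less_imp_le)
      qed (use b1 \<open>0 < H\<close> in simp)
      also have "\<dots> = (2 * b) ^ Suc n"
        unfolding power_divide[symmetric] using b1 \<open>0 < H\<close> by (simp add: field_simps)
      finally show "(\<Sum>i\<in>?J. (r i / g i) ^ Suc n) \<le> (2 * b) ^ Suc n" .
      have "(\<Sum>i\<in>?J. w i ^ Suc n) \<le> (\<Sum>i | i \<in> I \<and> dist (x i) p \<le> H / b ^ m. w i ^ Suc n)"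
        using \<open>finite I\<close> w gm by (intro sum_mono2) (auto simp: g_def h_def)
      also have "\<dots> \<le> B * (H / b ^ m)" using good[OF bm] by (simp add: n)
      finally show "(\<Sum>i\<in>?J. w i ^ Suc n) \<le> B * (H / b ^ m)" .
    qed (use l in auto)
    also have "\<dots> = A * (1 / 2) ^ m"
    proof -
      \<comment> \<open>Dividing by \<open>l ^ n\<close> costs the factor
        \<open>2 ^ (m * n)\<close>, and \<open>b ^ m\<close> gains \<open>2 ^ (m * n + m)\<close>;
        the surplus \<open>2 ^ m\<close> makes the series geometric.\<close>
      define e :: real where "e = 2 ^ (m * n)"
      have e: "e > 0" by (simp add: e_def)
      have half: "(1 / 2 :: real) ^ m = 1 / 2 ^ m" by (simp only: power_divide power_one)
      have bm_eq: "b ^ m = e * 2 ^ m"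
      proof -
        have "b ^ m = 2 ^ (Suc n * m)" by (simp only: b_def power_mult)
        also have "Suc n * m = m * n + m" by simp
        finally show ?thesis by (simp only: e_def power_add)
      qed
      have l_eq: "l ^ n = \<Lambda> ^ n / e"
        by (simp only: l_def e_def power_divide power_mult)
      have "B * (H / b ^ m) / l ^ n = B * H / \<Lambda> ^ n * (1 / 2) ^ m"
        unfolding bm_eq l_eq half using e by simp
      moreover have "l * (2 * b) ^ Suc n = \<Lambda> * (2 * b) ^ Suc n * (1 / 2) ^ m"
        unfolding half by (simp add: l_def)
      ultimately show ?thesis by (simp only: A_def distrib_right)
    qed
    finally show ?thesis .
  qed
  have "(\<Sum>i\<in>I. w i * (r i / g i) ^ n) = (\<Sum>m<N. \<Sum>i | i \<in> I \<and> k i = m. w i * (r i / g i) ^ n)"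
    using \<open>finite I\<close> N by (intro sum.group[symmetric]) auto
  also have "\<dots> \<le> (\<Sum>m<N. A * (1 / 2) ^ m)" by (rule sum_mono) (rule level)
  also have "\<dots> = A * (\<Sum>m<N. (1 / 2) ^ m)" by (simp add: sum_distrib_left)
  also have "\<dots> \<le> 2 * A"
  proof (subst mult.commute[of 2], rule mult_left_mono)
    show "(\<Sum>m<N. (1 / 2 :: real) ^ m) \<le> 2"
    proof -
      define S where "S = (\<Sum>m<N. (1 / 2 :: real) ^ m)"
      define q where "q = (1 / 2 :: real) ^ N"
      have "(1 - 1 / 2) * S = 1 - q"
        unfolding S_def q_def by (rule one_diff_power_eq[symmetric])
      moreover have "0 \<le> q" unfolding q_def by (rule zero_le_power) simp
      ultimately show ?thesis unfolding S_def[symmetric] by simp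
    qed
    have "0 \<le> (\<Sum>i | i \<in> I \<and> dist (x i) p \<le> 1. w i ^ DIM('a))"
      using w by (intro sum_nonneg) auto
    then have "0 \<le> B" using good[of 1] by simp
    then show "0 \<le> A" 
      unfolding A_def using L b1 \<open>0 < H\<close>
      by (intro add_nonneg_nonneg mult_nonneg_nonneg divide_nonneg_pos zero_le_power zero_less_power) auto
  qed
  finally show ?thesis by (simp only: A_def b_def g_def n diff_Suc_1)
qed


subsection \<open>A discrete Loewner inequality\<close>

text \<open>As \<open>b - z\<close> and \<open>e\<close> form no obtuse angle, the segment from
  \<open>b\<close> to \<open>z + (2 * a) *\<^sub>R e\<close> keeps away from \<open>z\<close>: the
  squared distance in units of \<open>a\<close> is at least
  \<open>5 * (u - 1/5)\<^sup>2 + 4/5\<close>, hence at least \<open>9 / 16\<close>. Moving the end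
  point by \<open>a / 4\<close> leaves the bound \<open>3 / 4 - 1 / 4 = 1 / 2\<close>.\<close>

lemma closed_segment_subset_ring:
  fixes z b e X :: "'a::euclidean_space"
  assumes a: "0 < a" and b: "a \<le> dist z b" "dist z b \<le> 2 * a" and e: "norm e = 1" "0 \<le> (b - z) \<bullet> e"
    and X: "dist (z + (2 * a) *\<^sub>R e) X \<le> a / 4"
  shows "closed_segment b X \<subseteq> {y. a / 2 \<le> dist z y \<and> dist z y \<le> 3 * a}"
proof
  fix y assume "y \<in> closed_segment b X"
  then obtain u where u: "0 \<le> u" "u \<le> 1" and y: "y = (1 - u) *\<^sub>R b + u *\<^sub>R X"
    unfolding in_segment by blast
  define g where "g = (1 - u) *\<^sub>R (b - z) + (2 * a * u) *\<^sub>R e"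
  define \<xi> where "\<xi> = X - (z + (2 * a) *\<^sub>R e)"
  have yz: "y - z = g + u *\<^sub>R \<xi>"
    by (simp add: y g_def \<xi>_def algebra_simps)
  have "norm (u *\<^sub>R \<xi>) \<le> 1 * (a / 4)"
    unfolding norm_scaleR using u X by (intro mult_mono) (auto simp: \<xi>_def dist_norm norm_minus_commute)
  then have x: "norm (u *\<^sub>R \<xi>) \<le> a / 4" by simp
  have nb: "a \<le> norm (b - z)" "norm (b - z) \<le> 2 * a" using b by (simp_all add: dist_norm norm_minus_commute)
  have "norm g \<le> (1 - u) * norm (b - z) + 2 * a * u"
    unfolding g_def using u a e by (intro order.trans[OF norm_triangle_ineq]) simp
  also have "\<dots> \<le> (1 - u) * (2 * a) + 2 * a * u"
    using u nb by (intro add_right_mono mult_left_mono) auto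
  finally have up: "norm g \<le> 2 * a" by (simp add: algebra_simps)
  have ee: "e \<bullet> e = 1" using e(1) by (simp add: norm_eq_1)
  have "(norm g)\<^sup>2 = (1 - u)\<^sup>2 * (norm (b - z))\<^sup>2 + 4 * a\<^sup>2 * u\<^sup>2 + 4 * a * u * (1 - u) * ((b - z) \<bullet> e)"
    unfolding g_def power2_norm_eq_inner
    by (simp only: inner_add_left inner_add_right inner_scaleR_left inner_scaleR_right ee inner_commute[of e "b - z"])
      (simp add: power2_eq_square algebra_simps)
  also have "\<dots> \<ge> (1 - u)\<^sup>2 * a\<^sup>2 + 4 * a\<^sup>2 * u\<^sup>2 + 0"
    using u a e nb by (intro add_mono mult_left_mono power_mono mult_nonneg_nonneg) auto
  also have "(1 - u)\<^sup>2 * a\<^sup>2 + 4 * a\<^sup>2 * u\<^sup>2 + 0 = a\<^sup>2 * (5 * (u - 1/5)\<^sup>2 + 4/5)"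
    by (simp add: power2_eq_square algebra_simps)
  also have "\<dots> \<ge> a\<^sup>2 * (9 / 16)"
  proof (rule mult_left_mono)
    show "9 / 16 \<le> 5 * (u - 1/5)\<^sup>2 + 4/5" using zero_le_power2[of "u - 1/5"] by linarith
  qed simp
  finally have "(3 / 4 * a)\<^sup>2 \<le> (norm g)\<^sup>2" by (simp add: power_mult_distrib power2_eq_square)
  then have lo: "3 / 4 * a \<le> norm g" by (rule power2_le_imp_le) simp
  have "norm g - norm (u *\<^sub>R \<xi>) \<le> norm (y - z)" "norm (y - z) \<le> norm g + norm (u *\<^sub>R \<xi>)"
    unfolding yz by (rule norm_diff_ineq, rule norm_triangle_ineq)
  then show "y \<in> {y. a / 2 \<le> dist z y \<and> dist z y \<le> 3 * a}"
    using x lo up a by (simp add: dist_norm norm_minus_commute)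
qed

text \<open>Far from \<open>b\<close> this is the shadow estimate. When
  \<open>dist x b \<le> 10 * r\<close>, the whole ball of end points serves, since the last factor
  is then bounded below. The enlargement \<open>5 * r\<close> is that of a Vitali covering.\<close>

lemma exists_hit_set:
  fixes b x c :: "'a::euclidean_space"
  assumes a: "0 < a" and r: "0 < r" and near: "\<And>X. X \<in> ball c (a / 4) \<Longrightarrow> dist X b \<le> 6 * a"
  obtains G where "G \<in> fmeasurable lborel"
    "\<And>X. X \<in> ball c (a / 4) \<Longrightarrow> closed_segment b X \<inter> ball x (5 * r) \<noteq> {} \<Longrightarrow> X \<in> G"
    "measure lborel G \<le> unit_ball_vol (DIM('a)) * (240 * a) ^ DIM('a)
        * (r / max (dist x b) r) ^ (DIM('a) - 1)"
proof -
  have e: "(240 * a) ^ k = (24 * a) ^ k * 10 ^ k" for k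
  proof -
    have "240 * a = 24 * a * 10" by simp
    then show ?thesis by (simp only: power_mult_distrib)
  qed
  show ?thesis
  proof (cases "10 * r < dist x b")
    case True
    define V where "V = unit_ball_vol (DIM('a))"
    obtain n where n: "DIM('a) = Suc n" using DIM_positive[where 'a='a] by (metis gr0_implies_Suc)
    obtain G where G: "G \<in> fmeasurable lborel"
      "\<And>X. dist X b \<le> 6 * a \<Longrightarrow> closed_segment b X \<inter> ball x (5 * r) \<noteq> {} \<Longrightarrow> X \<in> G"
      "measure lborel G \<le> 2 * V * (4 * (6 * a)) ^ DIM('a) * (5 * r / dist x b) ^ (DIM('a) - 1)"
      unfolding V_def by (rule measure_shadow_le[of "5 * r" x b "6 * a"]) (use True a r in auto)
    have m: "max (dist x b) r = dist x b" using True r by simp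
    note G(3)
    also have "2 * V * (4 * (6 * a)) ^ DIM('a) * (5 * r / dist x b) ^ (DIM('a) - 1)
        = V * (24 * a) ^ Suc n * (r / dist x b) ^ n * (2 * 5 ^ n)"
      unfolding n diff_Suc_1 times_divide_eq_right[symmetric] power_mult_distrib[of 5]
      by (simp only: mult_ac) simp
    also have "\<dots> \<le> V * (24 * a) ^ Suc n * (r / dist x b) ^ n * 10 ^ Suc n"
    proof (rule mult_left_mono)
      have "(5::real) ^ n \<le> 10 ^ n" by (intro power_mono) auto
      moreover have "0 \<le> (10::real) ^ n" by simp
      ultimately show "2 * 5 ^ n \<le> (10::real) ^ Suc n" unfolding power_Suc by linarith
    qed (use a r in \<open>simp add: V_def\<close>)
    also have "\<dots> = V * (240 * a) ^ DIM('a) * (r / max (dist x b) r) ^ (DIM('a) - 1)"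
      unfolding m n e by (simp only: diff_Suc_1 mult_ac)
    finally show ?thesis using that[of G] G near unfolding V_def by auto
  next
    case False
    define V where "V = unit_ball_vol (DIM('a))"
    obtain n where n: "DIM('a) = Suc n" using DIM_positive[where 'a='a] by (metis gr0_implies_Suc)
    have "1 / 10 \<le> r / max (dist x b) r" using False r by (simp add: field_simps)
    then have *: "(1 / 10) ^ n \<le> (r / max (dist x b) r) ^ n" by (intro power_mono) auto
    have "measure lborel (ball c (a / 4)) = V * (a / 4) ^ Suc n"
      using a by (simp add: content_ball V_def n)
    also have "\<dots> \<le> V * (24 * a) ^ Suc n"
      using a by (intro mult_left_mono power_mono) (auto simp: V_def)
    also have "\<dots> = V * (24 * a) ^ Suc n * (10 ^ n * (1 / 10) ^ n)"
      unfolding power_mult_distrib[symmetric] by simp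
    also have "\<dots> \<le> V * (24 * a) ^ Suc n * (10 ^ Suc n * (r / max (dist x b) r) ^ n)"
      using * a by (intro mult_left_mono mult_mono) (auto simp: V_def)
    also have "\<dots> = V * (240 * a) ^ DIM('a) * (r / max (dist x b) r) ^ (DIM('a) - 1)"
      unfolding n e by (simp only: diff_Suc_1 mult_ac)
    finally show ?thesis
      using that[of "ball c (a / 4)"] fmeasurableI[OF _ emeasure_lborel_ball_finite[of c "a / 4"]] unfolding V_def by simp
  qed
qed

text \<open>The base points \<open>p\<close> and \<open>q\<close> come from
  \<open>exists_good_radius\<close>, so little energy concentrates near them. Paths run from
  \<open>p\<close> to \<open>q\<close> with one corner \<open>X\<close>, uniformly distributed in a
  small ball. The parameter \<open>\<Lambda>\<close> stays free, to be balanced against the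
  energy.\<close>

lemma ln_ratio_le_of_covering:
  fixes z :: "'a::euclidean_space" and x :: "'i \<Rightarrow> 'a" and r R D :: "'i \<Rightarrow> real" and v :: "'a \<Rightarrow> real"
  defines "n \<equiv> DIM('a)"
  assumes n2: "2 \<le> DIM('a)" and a: "0 < a" and s: "0 < s" "s \<le> t"
    and cont: "continuous_on {y. a / 2 \<le> dist z y \<and> dist z y \<le> 3 * a} v"
    and small: "\<And>\<rho>. \<rho> \<in> {a..2 * a} \<Longrightarrow> \<exists>p\<in>sphere z \<rho>. v p \<le> s"
    and large: "\<And>\<rho>. \<rho> \<in> {a..2 * a} \<Longrightarrow> \<exists>q\<in>sphere z \<rho>. t \<le> v q"
    and I: "finite I" and r: "\<And>i. i \<in> I \<Longrightarrow> 0 < r i \<and> r i \<le> a"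
    and x: "\<And>i. i \<in> I \<Longrightarrow> dist z (x i) \<le> 3 * a"
    and disj: "disjoint_family_on (\<lambda>i. ball (x i) (r i)) I"
    and R: "\<And>i. i \<in> I \<Longrightarrow> 0 \<le> R i \<and> R i \<le> D i / 4 \<and> 0 < D i"
    and cov: "\<And>y. a / 2 \<le> dist z y \<Longrightarrow> dist z y \<le> 3 * a \<Longrightarrow> s \<le> v y \<Longrightarrow> v y \<le> t \<Longrightarrow>
        \<exists>i\<in>I. y \<in> ball (x i) (5 * r i) \<and> \<bar>v y - D i\<bar> \<le> R i"
    and L: "0 < \<Lambda>"
  shows "ln (t / s) \<le>
    960 ^ n * 4 * (\<Lambda> * (2 * 2 ^ n) ^ n + 60 * (\<Sum>i\<in>I. (3 * R i / D i) ^ n) / \<Lambda> ^ (n - 1))"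
proof -
  define w where "w i = 3 * R i / D i" for i
  define E where "E = (\<Sum>i\<in>I. w i ^ n)"
  define W where "W = {y. a / 2 \<le> dist z y \<and> dist z y \<le> 3 * a}"
  define V where "V = unit_ball_vol (DIM('a))"
  have w0: "0 \<le> w i" if "i \<in> I" for i using R[OF that] by (simp add: w_def)
  have V0: "V > 0" by (simp add: V_def)
  define h where "h b i = max (dist (x i) b) (r i)" for b i
  have good: "\<exists>p. a \<le> dist z p \<and> dist z p \<le> 2 * a \<and> Q p \<and>
      (\<forall>\<sigma>>0. (\<Sum>i | i \<in> I \<and> dist (x i) p \<le> \<sigma>. w i ^ DIM('a)) \<le> 10 * E / a * \<sigma>)"
    if Q: "\<And>\<rho>. \<rho> \<in> {a..2 * a} \<Longrightarrow> \<exists>p\<in>sphere z \<rho>. Q p" for Q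
  proof -
    obtain P where P: "\<And>\<rho>. \<rho> \<in> {a..2 * a} \<Longrightarrow> dist z (P \<rho>) = \<rho> \<and> Q (P \<rho>)"
      using Q by (metis mem_sphere)
    obtain \<rho> where "\<rho> \<in> {a..2 * a}"
      "\<And>\<sigma>. 0 < \<sigma> \<Longrightarrow> (\<Sum>i | i \<in> I \<and> dist (x i) (P \<rho>) \<le> \<sigma>. w i ^ n) \<le> 10 * \<sigma> / a * (\<Sum>i\<in>I. w i ^ n)"
    proof (rule exists_good_radius[of I "\<lambda>i. w i ^ n" a z P x])
      show "dist z (P \<rho>) = \<rho>" if "\<rho> \<in> {a..2 * a}" for \<rho> using P[OF that] by simp
    qed (use I w0 a in auto)
    then show ?thesis using P[of \<rho>] by (intro exI[of _ "P \<rho>"]) (auto simp: E_def n_def mult_ac)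
  qed
  obtain p where p: "a \<le> dist z p" "dist z p \<le> 2 * a" "v p \<le> s"
    "\<And>\<sigma>. 0 < \<sigma> \<Longrightarrow> (\<Sum>i | i \<in> I \<and> dist (x i) p \<le> \<sigma>. w i ^ DIM('a)) \<le> 10 * E / a * \<sigma>"
    using good[OF small] by blast
  obtain q where q: "a \<le> dist z q" "dist z q \<le> 2 * a" "t \<le> v q"
    "\<And>\<sigma>. 0 < \<sigma> \<Longrightarrow> (\<Sum>i | i \<in> I \<and> dist (x i) q \<le> \<sigma>. w i ^ DIM('a)) \<le> 10 * E / a * \<sigma>"
    using good[OF large] by blast
  \<comment> \<open>In dimension at least two there is a direction orthogonal to
    \<open>p - z\<close>; its sign is still free and is chosen to suit \<open>q\<close>, so that
    both segments stay in the ring.\<close>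
  obtain e where e: "norm e = 1" "(p - z) \<bullet> e = 0" "0 \<le> (q - z) \<bullet> e"
  proof -
    obtain y where y: "y \<noteq> 0" "orthogonal (p - z) y"
      using orthogonal_to_vector_exists[OF n2] by blast
    define f where "f = sgn y"
    have f: "norm f = 1" "(p - z) \<bullet> f = 0"
      using y by (auto simp: f_def norm_sgn sgn_div_norm orthogonal_def)
    show ?thesis
    proof (cases "0 \<le> (q - z) \<bullet> f")
      case True then show ?thesis using that[of f] f by simp
    next
      case False then show ?thesis using that[of "- f"] f by simp
    qed
  qed
  define c where "c = z + (2 * a) *\<^sub>R e"
  have seg: "closed_segment b X \<subseteq> W" if "b \<in> {p, q}" "X \<in> ball c (a / 4)" for b X
    unfolding W_def using that p q e a by (intro closed_segment_subset_ring[of a z b e X]) (auto simp: c_def)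
  have near: "dist X b \<le> 6 * a" if "b \<in> {p, q}" "X \<in> ball c (a / 4)" for b X
    using seg[OF that] dist_triangle2[of X b z] p q that(1) a
    by (auto simp: W_def dist_commute dest!: subsetD[OF _ ends_in_segment(2)])
  have hit: "\<exists>G. G \<in> fmeasurable lborel \<and>
      (\<forall>X \<in> ball c (a / 4). closed_segment b X \<inter> ball (x i) (5 * r i) \<noteq> {} \<longrightarrow> X \<in> G) \<and>
      measure lborel G \<le> V * (240 * a) ^ n * (r i / h b i) ^ (n - 1)"
    if b: "b \<in> {p, q}" and i: "i \<in> I" for b i
  proof -
    obtain G where "G \<in> fmeasurable lborel"
      "\<And>X. X \<in> ball c (a / 4) \<Longrightarrow> closed_segment b X \<inter> ball (x i) (5 * r i) \<noteq> {} \<Longrightarrow> X \<in> G"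
      "measure lborel G \<le> V * (240 * a) ^ n * (r i / h b i) ^ (n - 1)"
      unfolding V_def n_def h_def
      by (rule exists_hit_set[of a "r i" c b "x i"]) (use a r[OF i] near[OF b] in auto)
    then show ?thesis by blast
  qed
  then obtain G where G: "\<And>b i. b \<in> {p, q} \<Longrightarrow> i \<in> I \<Longrightarrow> G b i \<in> fmeasurable lborel"
    "\<And>b i X. b \<in> {p, q} \<Longrightarrow> i \<in> I \<Longrightarrow> X \<in> ball c (a / 4) \<Longrightarrow>
        closed_segment b X \<inter> ball (x i) (5 * r i) \<noteq> {} \<Longrightarrow> X \<in> G b i"
    "\<And>b i. b \<in> {p, q} \<Longrightarrow> i \<in> I \<Longrightarrow> measure lborel (G b i) \<le> V * (240 * a) ^ n * (r i / h b i) ^ (n - 1)"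
    by metis
  define T where "T = ln (t / s)"
  have "T * measure lborel (ball c (a / 4)) \<le> (\<Sum>i\<in>I. w i * measure lborel (G p i \<union> G q i))"
  proof (rule average_weighted_hits)
    show "T \<le> (\<Sum>i\<in>I. w i * indicator (G p i \<union> G q i) X)" if X: "X \<in> ball c (a / 4)" for X
    proof -
      define P where "P = closed_segment p X \<union> closed_segment q X"
      define J where "J = {i \<in> I. P \<inter> ball (x i) (5 * r i) \<noteq> {}}"
      have PW: "P \<subseteq> W" using seg X by (auto simp: P_def)
      have "T \<le> (\<Sum>i\<in>J. 3 * R i / D i)"
        unfolding T_def
      proof (rule ln_ratio_le_sum[of P v p s q t J])
        have "X \<in> closed_segment p X \<inter> closed_segment q X" by simp
        then show "connected P" unfolding P_def by (intro connected_Un) auto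
        show "continuous_on P v" using cont PW unfolding W_def by (rule continuous_on_subset)
        show "\<exists>i\<in>J. \<bar>v y - D i\<bar> \<le> R i" if y: "y \<in> P" "s \<le> v y" "v y \<le> t" for y
        proof -
          have "y \<in> W" using y PW by blast
          then obtain i where "i \<in> I" "y \<in> ball (x i) (5 * r i)" "\<bar>v y - D i\<bar> \<le> R i"
            using cov[of y] y by (auto simp: W_def)
          then show ?thesis using y unfolding J_def by blast
        qed
      qed (use p q s I R in \<open>auto simp: P_def J_def\<close>)
      also have "\<dots> = (\<Sum>i\<in>J. w i * indicator (G p i \<union> G q i) X)"
      proof (rule sum.cong[OF refl])
        fix i assume "i \<in> J"
        then have "X \<in> G p i \<union> G q i"
          using G(2)[of p i X] G(2)[of q i X] X by (auto simp: J_def P_def)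
        then show "3 * R i / D i = w i * indicator (G p i \<union> G q i) X" by (simp add: w_def)
      qed
      also have "\<dots> \<le> (\<Sum>i\<in>I. w i * indicator (G p i \<union> G q i) X)"
        using I w0 by (intro sum_mono2) (auto simp: J_def)
      finally show ?thesis .
    qed
    show "ball c (a / 4) \<in> fmeasurable lborel"
      by (rule fmeasurableI[OF _ emeasure_lborel_ball_finite]) simp
  qed (use I w0 G(1) in \<open>auto intro!: fmeasurable.Un\<close>)
  also have "\<dots> \<le> (\<Sum>i\<in>I. w i * (V * (240 * a) ^ n * (r i / h p i) ^ (n - 1)
      + V * (240 * a) ^ n * (r i / h q i) ^ (n - 1)))"
  proof (intro sum_mono mult_left_mono w0)
    fix i assume i: "i \<in> I"
    have "measure lborel (G p i \<union> G q i) \<le> measure lborel (G p i) + measure lborel (G q i)"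
      using G(1)[of p i] G(1)[of q i] i by (intro measure_Un_le) auto
    then show "measure lborel (G p i \<union> G q i) \<le> V * (240 * a) ^ n * (r i / h p i) ^ (n - 1)
      + V * (240 * a) ^ n * (r i / h q i) ^ (n - 1)"
      using G(3)[of p i] G(3)[of q i] i by simp
  qed
  also have "\<dots> = V * (240 * a) ^ n * ((\<Sum>i\<in>I. w i * (r i / h p i) ^ (n - 1)) + (\<Sum>i\<in>I. w i * (r i / h q i) ^ (n - 1)))"
    by (simp add: sum_distrib_left sum.distrib algebra_simps)
  also have "\<dots> \<le> V * (240 * a) ^ n * (2 * (2 * (\<Lambda> * (2 * 2 ^ n) ^ n + (10 * E / a) * (6 * a) / \<Lambda> ^ (n - 1))))"
  proof (rule mult_left_mono)
    have bound: "(\<Sum>i\<in>I. w i * (r i / h b i) ^ (n - 1))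
        \<le> 2 * (\<Lambda> * (2 * 2 ^ n) ^ n + (10 * E / a) * (6 * a) / \<Lambda> ^ (n - 1))"
      if b: "b \<in> {p, q}" for b
      unfolding n_def h_def
    proof (rule sum_hitting_weights_le)
      show "max (dist (x i) b) (r i) \<le> 6 * a" if "i \<in> I" for i
        using x[OF that] r[OF that] b p q dist_triangle3[of "x i" b z] a by auto
    qed (use I r disj w0 L a b p q in auto)
    show "(\<Sum>i\<in>I. w i * (r i / h p i) ^ (n - 1)) + (\<Sum>i\<in>I. w i * (r i / h q i) ^ (n - 1))
        \<le> 2 * (2 * (\<Lambda> * (2 * 2 ^ n) ^ n + (10 * E / a) * (6 * a) / \<Lambda> ^ (n - 1)))"
      using bound[of p] bound[of q] by simp
  qed (use V0 a in auto)
  also have "measure lborel (ball c (a / 4)) = V * (a / 4) ^ n"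
    using a by (simp add: content_ball V_def n_def)
  \<comment> \<open>\<open>960\<close> is the ratio of \<open>240 * a\<close> to the radius
    \<open>a / 4\<close> of the ball of corners.\<close>
  also have "V * (240 * a) ^ n = (V * (a / 4) ^ n) * 960 ^ n"
    unfolding mult.assoc power_mult_distrib[symmetric] by simp
  finally have "(V * (a / 4) ^ n) * T \<le> (V * (a / 4) ^ n) *
      (960 ^ n * (2 * (2 * (\<Lambda> * (2 * 2 ^ n) ^ n + (10 * E / a) * (6 * a) / \<Lambda> ^ (n - 1)))))"
    by (simp only: mult_ac)
  then have "T \<le> 960 ^ n * (2 * (2 * (\<Lambda> * (2 * 2 ^ n) ^ n + (10 * E / a) * (6 * a) / \<Lambda> ^ (n - 1))))"
    by (rule mult_left_le_imp_le) (use V0 a in simp)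
  moreover have "(10 * E / a) * (6 * a) = 60 * E" using a by simp
  ultimately have "T \<le> 960 ^ n * (2 * (2 * (\<Lambda> * (2 * 2 ^ n) ^ n + 60 * E / \<Lambda> ^ (n - 1))))"
    by (simp only:)
  also have "2 * (2 * Y) = 4 * Y" for Y :: real by simp
  finally show ?thesis
    unfolding T_def E_def w_def mult.assoc .
qed


subsection \<open>The ring estimate for homeomorphisms with bounded linear dilatation\<close>

text \<open>The limit superior from \<open>quasiconformal\<close>, named so that it can be bounded
  at single points of a map of the whole space.\<close>

definition linear_dilatation :: "('a::euclidean_space \<Rightarrow> 'a) \<Rightarrow> 'a \<Rightarrow> ereal" where
  "linear_dilatation f x = Limsup (at_right 0)
     (\<lambda>r. ereal ((SUP y\<in>sphere x r. norm (f x - f y)) / (INF z\<in>sphere x r. norm (f x - f z))))"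

text \<open>A maximum principle: \<open>F\<close> is open, so a point of the image farthest from
  \<open>F x\<close> cannot come from the interior of the ball.\<close>

lemma homeomorphism_image_cball_subset:
  fixes F :: "'a::euclidean_space \<Rightarrow> 'a"
  assumes F: "homeomorphism UNIV UNIV F G" and "0 < \<rho>"
    and L: "\<And>y. y \<in> sphere x \<rho> \<Longrightarrow> dist (F x) (F y) \<le> L"
  shows "F ` cball x \<rho> \<subseteq> cball (F x) L"
proof -
  have cont: "continuous_on S F" for S
    using F continuous_on_subset unfolding homeomorphism_def by blast
  have "sphere x \<rho> \<noteq> {}" using \<open>0 < \<rho>\<close> by simp
  then obtain y0 where "y0 \<in> sphere x \<rho>" by blast
  then have L0: "0 \<le> L" using L[of y0] zero_le_dist[of "F x" "F y0"] by linarith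
  have "compact (F ` cball x \<rho>)" using cont by (intro compact_continuous_image) auto
  then obtain p where p: "p \<in> F ` cball x \<rho>" "\<And>y. y \<in> F ` cball x \<rho> \<Longrightarrow> dist (F x) y \<le> dist (F x) p"
    using continuous_attains_sup[of "F ` cball x \<rho>" "dist (F x)"] \<open>0 < \<rho>\<close>
    by (force intro: continuous_intros)
  have "dist (F x) p \<le> L"
  proof (rule ccontr)
    assume far: "\<not> dist (F x) p \<le> L"
    obtain y where y: "y \<in> cball x \<rho>" "p = F y" using p by blast
    with far L have "y \<in> ball x \<rho>" by (force simp: less_le)
    then have "p \<in> F ` ball x \<rho>" using y by blast
    moreover have "open (F ` ball x \<rho>)"
      using homeomorphism_imp_open_map[OF F, of "ball x \<rho>"] by simp
    ultimately obtain e where e: "e > 0" "ball p e \<subseteq> F ` ball x \<rho>"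
      using open_contains_ball by blast
    have np: "norm (p - F x) > 0" using far L0 by (auto simp: dist_norm)
    \<comment> \<open>A move outward from \<open>p\<close> by \<open>e / 2\<close> stays in the
      image, against the maximality of \<open>p\<close>.\<close>
    define q where "q = p + (e / 2 / norm (p - F x)) *\<^sub>R (p - F x)"
    have "dist p q = e / 2" using np e by (simp add: q_def dist_norm)
    then have "q \<in> ball p e" using e by simp
    then have "q \<in> F ` cball x \<rho>" using e(2) ball_subset_cball by blast
    moreover have "q - F x = (1 + e / 2 / norm (p - F x)) *\<^sub>R (p - F x)"
      by (simp add: q_def algebra_simps)
    then have "dist (F x) q = (1 + e / 2 / norm (p - F x)) * norm (p - F x)"
      using np e by (simp add: dist_norm norm_minus_commute[of "F x"])
    then have "dist (F x) q = dist (F x) p + e / 2"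
      using np by (simp add: distrib_right dist_norm norm_minus_commute[of "F x"])
    ultimately show False using p(2)[of q] e by simp
  qed
  then show ?thesis using p(2) by fastforce
qed

text \<open>The ball around \<open>F x\<close> is connected, so if it left the image it would meet
  the frontier of the image, which lies in the image of the sphere.\<close>

lemma ball_subset_homeomorphism_image:
  fixes F :: "'a::euclidean_space \<Rightarrow> 'a"
  assumes F: "homeomorphism UNIV UNIV F G" and "0 < \<rho>"
    and l: "\<And>y. y \<in> sphere x \<rho> \<Longrightarrow> l \<le> dist (F x) (F y)"
  shows "ball (F x) l \<subseteq> F ` ball x \<rho>"
proof (rule ccontr)
  assume "\<not> ball (F x) l \<subseteq> F ` ball x \<rho>"
  moreover from this have "0 < l" by (metis ball_empty empty_subsetI not_le)
  then have "F x \<in> ball (F x) l \<inter> F ` ball x \<rho>" using \<open>0 < \<rho>\<close> by simp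
  then have "ball (F x) l \<inter> F ` ball x \<rho> \<noteq> {}" by blast
  ultimately have "ball (F x) l \<inter> frontier (F ` ball x \<rho>) \<noteq> {}"
    by (intro connected_Int_frontier) auto
  then obtain p where p: "p \<in> ball (F x) l" "p \<in> frontier (F ` ball x \<rho>)" by blast
  have cont: "continuous_on S F" for S
    using F continuous_on_subset unfolding homeomorphism_def by blast
  have "open (F ` ball x \<rho>)"
    using homeomorphism_imp_open_map[OF F, of "ball x \<rho>"] by simp
  moreover have "closed (F ` cball x \<rho>)"
    using cont by (intro compact_imp_closed compact_continuous_image) auto
  then have "closure (F ` ball x \<rho>) \<subseteq> F ` cball x \<rho>"
    by (intro closure_minimal image_mono) auto
  ultimately have "p \<in> F ` cball x \<rho>" "p \<notin> F ` ball x \<rho>"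
    using p(2) by (auto simp: frontier_def interior_open)
  then obtain y where "y \<in> sphere x \<rho>" "p = F y" by force
  then show False using l p(1) by force
qed

text \<open>Some ratio of consecutive spheres does not grow by more than a factor \<open>10\<close>, or else \<open>F\<close>
  contracts faster than any linear rate along the sequence of radii \<open>\<rho> / 5 ^ j\<close>.\<close>

lemma exists_round_radius:
  fixes F :: "'a::euclidean_space \<Rightarrow> 'a"
  assumes F: "homeomorphism UNIV UNIV F G" and K: "0 \<le> K"
    and dil: "linear_dilatation F x \<le> ereal K"
    and pos: "0 < \<epsilon>" "0 < \<eta>" "0 < \<kappa>"
  obtains r R where "0 < r" "r \<le> \<eta>" "0 \<le> R" "R \<le> \<kappa>" "F ` cball x (5 * r) \<subseteq> cball (F x) R"
    "ball (F x) (R / (10 * (K + 1))) \<subseteq> F ` ball x r \<or> R \<le> \<epsilon> * r"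
proof -
  define L where "L \<rho> = (SUP y\<in>sphere x \<rho>. norm (F x - F y))" for \<rho>
  define l where "l \<rho> = (INF y\<in>sphere x \<rho>. norm (F x - F y))" for \<rho>
  have contF: "continuous_on S F" for S
    using F continuous_on_subset unfolding homeomorphism_def by blast
  have inj: "inj F" using F by (auto simp: homeomorphism_def intro: inj_on_inverseI[of UNIV G])
  have cont: "continuous_on S (\<lambda>y. norm (F x - F y))" for S
    by (intro continuous_intros contF)
  have comp: "compact ((\<lambda>y. norm (F x - F y)) ` sphere x \<rho>)" for \<rho>
    using cont by (intro compact_continuous_image) auto
  have L_ge: "norm (F x - F y) \<le> L \<rho>" if "y \<in> sphere x \<rho>" for y \<rho>
    unfolding L_def using that comp by (intro cSUP_upper) (auto intro!: bounded_imp_bdd_above[OF compact_imp_bounded[OF comp]])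
  have l_le: "l \<rho> \<le> norm (F x - F y)" if "y \<in> sphere x \<rho>" for y \<rho>
    unfolding l_def using that comp by (intro cINF_lower) (auto intro!: bounded_imp_bdd_below[OF compact_imp_bounded[OF comp]])
  have l_pos: "0 < l \<rho>" if "0 < \<rho>" for \<rho>
  proof -
    obtain y where y: "y \<in> sphere x \<rho>" "\<And>y'. y' \<in> sphere x \<rho> \<Longrightarrow> norm (F x - F y) \<le> norm (F x - F y')"
    proof -
      have "compact (sphere x \<rho>)" "sphere x \<rho> \<noteq> {}" using \<open>0 < \<rho>\<close> by simp_all
      from continuous_attains_inf[OF this cont] show ?thesis using that by blast
    qed
    have "y \<noteq> x" using y(1) that by auto
    then have "0 < norm (F x - F y)" using inj by (auto dest: injD)
    also have "\<dots> \<le> l \<rho>" unfolding l_def using y that by (intro cINF_greatest) auto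
    finally show ?thesis .
  qed
  have L_nn: "0 \<le> L \<rho>" if "0 < \<rho>" for \<rho>
  proof -
    have "sphere x \<rho> \<noteq> {}" using \<open>0 < \<rho>\<close> by simp
    then obtain y where "y \<in> sphere x \<rho>" by blast
    then show ?thesis using L_ge norm_ge_zero order_trans by blast
  qed
  \<comment> \<open>The strict bound \<open>K + 1\<close> above the limit superior holds on all
    sufficiently small spheres.\<close>
  have "linear_dilatation F x < ereal (K + 1)" using dil by (rule le_less_trans) simp
  then have "\<forall>\<^sub>F \<rho> in at_right 0. ereal (L \<rho> / l \<rho>) < ereal (K + 1)"
    unfolding linear_dilatation_def L_def l_def by (rule Limsup_lessD)
  then obtain r1 where r1: "0 < r1" "\<And>\<rho>. 0 < \<rho> \<Longrightarrow> \<rho> < r1 \<Longrightarrow> L \<rho> / l \<rho> < K + 1"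
    by (auto simp: eventually_at_right_field)
  obtain d where d: "d > 0" "\<And>y. dist y x < d \<Longrightarrow> dist (F y) (F x) < \<kappa>"
    using contF[of UNIV] pos unfolding continuous_on_iff by (metis UNIV_I)
  define r0 where "r0 = min (min (r1 / 2) \<eta>) (d / 2)"
  have r0: "0 < r0" "r0 < r1" "r0 \<le> \<eta>" "r0 < d" using r1 pos d by (auto simp: r0_def)
  have L_kappa: "L \<rho> \<le> \<kappa>" if "0 < \<rho>" "\<rho> \<le> r0" for \<rho>
    unfolding L_def
  proof (rule cSUP_least)
    show "sphere x \<rho> \<noteq> {}" using that by simp
    show "norm (F x - F y) \<le> \<kappa>" if "y \<in> sphere x \<rho>" for y
      using d(2)[of y] that \<open>\<rho> \<le> r0\<close> r0 by (simp add: dist_norm norm_minus_commute)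
  qed
  define \<rho> where "\<rho> j = r0 / 5 ^ j" for j :: nat
  have \<rho>: "0 < \<rho> j" "\<rho> j \<le> r0" "\<rho> j = 5 * \<rho> (Suc j)" for j
    using r0 by (auto simp: \<rho>_def divide_le_eq)
  have "\<exists>j. L (\<rho> j) \<le> 10 * L (\<rho> (Suc j)) \<or> L (\<rho> j) \<le> \<epsilon> * \<rho> (Suc j)"
  proof (rule ccontr)
    assume "\<not> ?thesis"
    then have step: "10 * L (\<rho> (Suc j)) < L (\<rho> j)" and big: "\<epsilon> * \<rho> (Suc j) < L (\<rho> j)" for j
      by (auto simp: not_le)
    have dec: "L (\<rho> j) * 10 ^ j \<le> L r0" for j
    proof (induction j)
      case (Suc j)
      have "L (\<rho> (Suc j)) * 10 ^ Suc j = (10 * L (\<rho> (Suc j))) * 10 ^ j" by simp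
      also have "\<dots> \<le> L (\<rho> j) * 10 ^ j" using step[of j] by (intro mult_right_mono) auto
      also have "\<dots> \<le> L r0" by (rule Suc)
      finally show ?case .
    qed (simp add: \<rho>_def)
    \<comment> \<open>The tenfold decay of \<open>L\<close> against the fivefold decay of the radii
      leaves the unbounded factor \<open>2 ^ j\<close>.\<close>
    have "\<epsilon> * r0 / 5 * 2 ^ j < L r0" for j
    proof -
      have ten: "(10::real) ^ j = 5 ^ j * 2 ^ j" unfolding power_mult_distrib[symmetric] by simp
      have "\<epsilon> * r0 / 5 * 2 ^ j = \<epsilon> * \<rho> (Suc j) * 10 ^ j"
        unfolding ten by (simp add: \<rho>_def)
      also have "\<dots> < L (\<rho> j) * 10 ^ j" using big[of j] by (intro mult_strict_right_mono) auto
      finally show ?thesis using dec[of j] by simp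
    qed
    moreover obtain j where "L r0 / (\<epsilon> * r0 / 5) < 2 ^ j"
      using real_arch_pow[of 2 "L r0 / (\<epsilon> * r0 / 5)"] by auto
    moreover have "0 < \<epsilon> * r0 / 5" using pos r0 by simp
    ultimately show False by (simp only: pos_divide_less_eq mult.commute) (meson less_asym)
  qed
  then obtain j where j: "L (\<rho> j) \<le> 10 * L (\<rho> (Suc j)) \<or> L (\<rho> j) \<le> \<epsilon> * \<rho> (Suc j)" by blast
  let ?r = "\<rho> (Suc j)"
  show ?thesis
  proof (rule that[of ?r "L (\<rho> j)"])
    show "0 < ?r" "?r \<le> \<eta>" "0 \<le> L (\<rho> j)" "L (\<rho> j) \<le> \<kappa>"
      using \<rho>[of j] \<rho>[of "Suc j"] r0 L_nn L_kappa by (auto intro: order.trans)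
    show "F ` cball x (5 * ?r) \<subseteq> cball (F x) (L (\<rho> j))"
      unfolding \<rho>(3)[symmetric] using L_ge[of _ "\<rho> j"]
      by (intro homeomorphism_image_cball_subset[OF F] \<rho>(1)) (simp add: dist_norm[of "F _"])
    have "ball (F x) (L (\<rho> j) / (10 * (K + 1))) \<subseteq> F ` ball x ?r" if "L (\<rho> j) \<le> 10 * L ?r"
    proof -
      have "L ?r / l ?r < K + 1" using r1(2) \<rho>[of "Suc j"] r0 by simp
      then have "L ?r \<le> (K + 1) * l ?r" using l_pos[OF \<rho>(1)[of "Suc j"]] by (simp add: divide_less_eq)
      \<comment> \<open>One factor \<open>10\<close> passes from the outer to the inner sphere, and
        \<open>K + 1\<close> passes from the largest to the smallest distance on the inner
        one.\<close>
      then have "L (\<rho> j) \<le> (10 * (K + 1)) * l ?r"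
        using that unfolding mult.assoc by linarith
      then have "L (\<rho> j) / (10 * (K + 1)) \<le> l ?r" using K by (simp add: divide_le_eq mult.commute)
      then have "ball (F x) (L (\<rho> j) / (10 * (K + 1))) \<subseteq> ball (F x) (l ?r)" by (rule subset_ball)
      also have "\<dots> \<subseteq> F ` ball x ?r"
        using l_le[of _ ?r]
        by (intro ball_subset_homeomorphism_image[OF F] \<rho>(1)) (simp add: dist_norm[of "F _"])
      finally show ?thesis .
    qed
    then show "ball (F x) (L (\<rho> j) / (10 * (K + 1))) \<subseteq> F ` ball x ?r \<or> L (\<rho> j) \<le> \<epsilon> * ?r"
      using j by blast
  qed
qed

text \<open>The points \<open>y i\<close> are sorted into the shells \<open>s * exp m \<le> dist z (y i) < s * exp (m + 1)\<close>;
  each shell contributes at most a constant, by comparison of volumes.\<close>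

lemma sum_shells_le:
  fixes y :: "'i \<Rightarrow> 'a::euclidean_space"
  assumes I: "finite I" and A: "1 \<le> A" and s: "0 < s" "s \<le> t"
    and y: "\<And>i. i \<in> I \<Longrightarrow> s \<le> dist z (y i) \<and> dist z (y i) \<le> t"
    and R: "\<And>i. i \<in> I \<Longrightarrow> 0 \<le> R i \<and> R i \<le> dist z (y i) / 4"
    and disj: "disjoint_family_on (\<lambda>i. ball (y i) (R i / A)) I"
  shows "(\<Sum>i\<in>I. (3 * R i / dist z (y i)) ^ DIM('a)) \<le> (ln (t / s) + 1) * (18 * A) ^ DIM('a)"
proof -
  define D where "D i = dist z (y i)" for i
  define m where "m i = nat \<lfloor>ln (D i / s)\<rfloor>" for i
  define N where "N = nat \<lfloor>ln (t / s)\<rfloor>"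
  let ?n = "DIM('a)"
  have Di: "s \<le> D i" "D i \<le> t" if "i \<in> I" for i using y[OF that] by (auto simp: D_def)
  have mN: "m i \<le> N" if "i \<in> I" for i
    unfolding m_def N_def using Di[OF that] s by (intro nat_mono floor_mono) (simp add: divide_right_mono)
  have lnD: "m i \<le> ln (D i / s)" "ln (D i / s) < m i + 1" if "i \<in> I" for i
  proof -
    have "0 \<le> ln (D i / s)" using Di[OF that] s by (intro ln_ge_zero) simp
    then show "m i \<le> ln (D i / s)" "ln (D i / s) < m i + 1" unfolding m_def by linarith+
  qed
  have D: "s * exp (m i) \<le> D i" "D i < s * exp (m i) * exp 1" if "i \<in> I" for i
  proof -
    have pos: "0 < D i / s" using Di[OF that] s by simp
    have "exp (real (m i)) \<le> D i / s" using lnD(1)[OF that] pos by (simp add: ln_ge_iff)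
    then show "s * exp (m i) \<le> D i" using s by (simp add: field_simps)
    have "exp (ln (D i / s)) < exp (m i + 1)" using lnD(2)[OF that] by simp
    then show "D i < s * exp (m i) * exp 1" using pos s by (simp add: exp_add field_simps)
  qed
  have shell: "(\<Sum>i | i \<in> I \<and> m i = k. (3 * R i / D i) ^ ?n) \<le> (18 * A) ^ ?n" for k
  proof -
    let ?J = "{i \<in> I. m i = k}"
    define q where "q = s * exp k"
    have q: "0 < q" using s by (simp add: q_def)
    have "(\<Sum>i\<in>?J. (3 * R i / D i) ^ ?n) \<le> (\<Sum>i\<in>?J. (3 * A / q * (R i / A)) ^ ?n)"
    proof (intro sum_mono power_mono)
      fix i assume i: "i \<in> ?J"
      then have "q \<le> D i" "0 \<le> R i" using D[of i] R[of i] by (auto simp: q_def)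
      then show "3 * R i / D i \<le> 3 * A / q * (R i / A)" "0 \<le> 3 * R i / D i"
        using q A by (auto intro!: divide_left_mono)
    qed
    also have "\<dots> = (3 * A / q) ^ ?n * (\<Sum>i\<in>?J. (R i / A) ^ ?n)"
      by (simp only: power_mult_distrib sum_distrib_left)
    also have "\<dots> \<le> (3 * A / q) ^ ?n * (2 * (q * exp 1)) ^ ?n"
    proof (rule mult_left_mono)
      have "ball (y i) (R i / A) \<subseteq> ball z (2 * (q * exp 1))" if i: "i \<in> ?J" for i
      proof
        fix u assume u: "u \<in> ball (y i) (R i / A)"
        have "R i / A \<le> R i / 1" using A R[of i] i by (intro divide_left_mono) auto
        then have "R i / A \<le> D i" using R[of i] i by (auto simp: D_def)
        then have "dist z u < D i + D i" using u dist_triangle[of z u "y i"] by (simp add: D_def)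
        also have "\<dots> \<le> 2 * (q * exp 1)" using D(2)[of i] i by (simp add: q_def)
        finally show "u \<in> ball z (2 * (q * exp 1))" by simp
      qed
      then show "(\<Sum>i\<in>?J. (R i / A) ^ ?n) \<le> (2 * (q * exp 1)) ^ ?n"
        using I R A q disj
        by (intro sum_pow_radii_le disjoint_family_on_mono[of ?J I]) auto
    qed (use A q in simp)
    also have "\<dots> = (6 * exp 1 * A) ^ ?n"
    proof -
      have "3 * A / q * (2 * (q * exp 1)) = 6 * exp 1 * A" using q by simp
      then show ?thesis by (simp only: power_mult_distrib[symmetric])
    qed
    also have "\<dots> \<le> (18 * A) ^ ?n"
      using A exp_le by (intro power_mono mult_right_mono) auto
    finally show ?thesis .
  qed
  have "(\<Sum>i\<in>I. (3 * R i / D i) ^ ?n) = (\<Sum>k\<le>N. \<Sum>i | i \<in> I \<and> m i = k. (3 * R i / D i) ^ ?n)"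
    using I mN by (intro sum.group[symmetric]) auto
  also have "\<dots> \<le> (\<Sum>k\<le>N. (18 * A) ^ ?n)" by (rule sum_mono) (rule shell)
  also have "\<dots> = (N + 1) * (18 * A) ^ ?n" by simp
  also have "\<dots> \<le> (ln (t / s) + 1) * (18 * A) ^ ?n"
  proof (rule mult_right_mono)
    have "0 \<le> ln (t / s)" using s by simp
    then show "real (N + 1) \<le> ln (t / s) + 1" by (simp add: N_def)
  qed (use A in simp)
  finally show ?thesis by (simp add: D_def)
qed

section \<open>Balancing the energy: the ring estimate\<close>

text \<open>An upper bound for \<open>exp T\<close> when
  \<open>T \<le> c1 * \<Lambda> + c2 * c * T / \<Lambda>\<close>, with
  \<open>c1 = 960 ^ n * 4 * (2 * 2 ^ n) ^ n\<close> and \<open>c2 = 960 ^ n * 240\<close>: for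
  \<open>\<Lambda> \<ge> 2 * c2 * c\<close> the last term is at most \<open>T / 2\<close>. The outer
  \<open>max 1\<close> covers the case \<open>T \<le> 1\<close>.\<close>

definition ring_const :: "nat \<Rightarrow> real \<Rightarrow> real" where
  "ring_const n K =
     (let c = 2 * (18 * (10 * (K + 1))) ^ n + 1; \<Lambda> = max 1 (2 * (960 ^ n * 240) * c)
      in exp (max 1 (2 * (960 ^ n * 4 * (2 * 2 ^ n) ^ n) * \<Lambda>)))"

lemma ring_const_ge_1: "1 \<le> ring_const n K"
  by (simp add: ring_const_def Let_def)

text \<open>The covering inequality bounds \<open>T = ln (t / s)\<close> by a multiple of
  \<open>\<Lambda>\<close> plus the energy over a power of \<open>\<Lambda>\<close>, and volumes in
  the image bound the energy by a multiple of \<open>T\<close>. A large \<open>\<Lambda>\<close>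
  closes the estimate.\<close>

proposition quasiconformal_ring_estimate:
  fixes F :: "'a::euclidean_space \<Rightarrow> 'a"
  assumes n2: "2 \<le> DIM('a)" and F: "homeomorphism UNIV UNIV F G" and K: "0 \<le> K"
    and a: "0 < a" and s: "0 < s"
    and small: "\<And>\<rho>. \<rho> \<in> {a..2 * a} \<Longrightarrow> \<exists>p\<in>sphere z \<rho>. dist z' (F p) \<le> s"
    and large: "\<And>\<rho>. \<rho> \<in> {a..2 * a} \<Longrightarrow> \<exists>q\<in>sphere z \<rho>. t \<le> dist z' (F q)"
    and dil: "\<And>y. a / 2 \<le> dist z y \<Longrightarrow> dist z y \<le> 3 * a \<Longrightarrow> s \<le> dist z' (F y) \<Longrightarrow>
        dist z' (F y) \<le> t \<Longrightarrow> linear_dilatation F y \<le> ereal K"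
  shows "t \<le> ring_const (DIM('a)) K * s"
proof (cases "ln (t / s) \<le> 1 \<or> t \<le> s")
  case True
  then show ?thesis
  proof
    assume "t \<le> s"
    then show ?thesis using mult_right_mono[OF ring_const_ge_1, of s "DIM('a)" K] s by linarith
  next
    assume le: "ln (t / s) \<le> 1"
    show ?thesis
    proof (cases "0 < t")
      case True
      then have "t / s \<le> exp 1" using le s by (metis divide_pos_pos exp_le_cancel_iff exp_ln)
      also have "\<dots> \<le> ring_const (DIM('a)) K" by (simp add: ring_const_def Let_def)
      finally show ?thesis using s by (simp add: divide_le_eq)
    next
      case False
      then show ?thesis using mult_right_mono[OF ring_const_ge_1, of s "DIM('a)" K] s by linarith
    qed
  qed
next
  case False
  let ?n = "DIM('a)"
  define T where "T = ln (t / s)"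
  define v where "v y = dist z' (F y)" for y
  \<comment> \<open>From here on \<open>0 < s < t\<close>, and \<open>1 < T\<close> lets additive
    constants be absorbed into \<open>T\<close>.\<close>
  have T1: "1 < T" and st: "s < t" using False by (auto simp: T_def)
  define W where "W = {y. a / 2 \<le> dist z y \<and> dist z y \<le> 3 * a}"
  define A where "A = 10 * (K + 1)"
  have A1: "1 \<le> A" using K by (simp add: A_def)
  have contF: "continuous_on S F" for S
    using F continuous_on_subset unfolding homeomorphism_def by blast
  have inj: "inj F" using F by (auto simp: homeomorphism_def intro: inj_on_inverseI[of UNIV G])
  have contv: "continuous_on S v" for S
    unfolding v_def by (intro continuous_intros contF)
  define Q where "Q = {y \<in> W. s \<le> v y \<and> v y \<le> t}"
  have "closed Q"
    unfolding Q_def W_def mem_Collect_eq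
    by (intro closed_Collect_conj closed_Collect_le continuous_intros contv)
  moreover have "Q \<subseteq> cball z (3 * a)" by (auto simp: Q_def W_def)
  ultimately have "compact Q" by (metis bounded_cball bounded_subset compact_eq_bounded_closed)
  \<comment> \<open>Balls with \<open>R \<le> \<epsilon> * r\<close> then have weight at most
    \<open>r / (10 * a)\<close>; as they are disjoint and lie in \<open>ball z (10 * a)\<close>,
    their total energy is at most \<open>1\<close>.\<close>
  define \<epsilon> where "\<epsilon> = s / (30 * a)"
  have "\<exists>r R. 0 < r \<and> r \<le> a \<and> 0 \<le> R \<and> R \<le> s / 4 \<and> F ` cball y (5 * r) \<subseteq> cball (F y) R \<and>
      (ball (F y) (R / A) \<subseteq> F ` ball y r \<or> R \<le> \<epsilon> * r)" if "y \<in> Q" for y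
  proof -
    have "linear_dilatation F y \<le> ereal K" using that dil by (auto simp: Q_def W_def v_def)
    then show ?thesis
      using exists_round_radius[OF F K, of y \<epsilon> a "s / 4"] a s unfolding A_def \<epsilon>_def
      by (metis divide_pos_pos zero_less_mult_iff zero_less_numeral)
  qed
  then obtain r R where rR: "\<And>y. y \<in> Q \<Longrightarrow> 0 < r y \<and> r y \<le> a \<and> 0 \<le> R y \<and> R y \<le> s / 4 \<and>
      F ` cball y (5 * r y) \<subseteq> cball (F y) (R y) \<and>
      (ball (F y) (R y / A) \<subseteq> F ` ball y (r y) \<or> R y \<le> \<epsilon> * r y)"
    by metis
  have "Q \<subseteq> (\<Union>y\<in>Q. ball y (r y))" using rR by force
  then obtain Y where Y: "Y \<subseteq> Q" "finite Y" "Q \<subseteq> (\<Union>y\<in>Y. ball y (r y))"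
    by (rule compactE_image[OF \<open>compact Q\<close>, rotated]) auto
  \<comment> \<open>The disjoint balls cover \<open>Q\<close> only after enlargement by
    \<open>5\<close>, which is why \<open>R y\<close> controls \<open>F\<close> on
    \<open>cball y (5 * r y)\<close>.\<close>
  obtain I where I: "I \<subseteq> Y" "pairwise (\<lambda>i j. disjnt (cball i (r i)) (cball j (r j))) I"
    "\<And>i. i \<in> Y \<Longrightarrow> \<exists>j. j \<in> I \<and> \<not> disjnt (cball i (r i)) (cball j (r j)) \<and>
          cball i (r i) \<subseteq> ball j (5 * r j)"
  proof (rule Vitali_covering_lemma_cballs_balls[of Y r a "\<lambda>y. y"])
    show "0 < r i \<and> r i \<le> a" if "i \<in> Y" for i using that Y rR by blast
  qed (rule that)
  have IQ: "i \<in> Q" if "i \<in> I" for i using that I Y by blast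
  have "finite I" using I Y finite_subset by blast
  have disj: "disjoint_family_on (\<lambda>i. ball i (r i)) I"
    using I(2) ball_subset_cball unfolding disjoint_family_on_def pairwise_def disjnt_def by blast
  have vI: "s \<le> v i" "v i \<le> t" if "i \<in> I" for i using IQ[OF that] by (auto simp: Q_def)
  have Rv: "0 \<le> R i \<and> R i \<le> v i / 4 \<and> 0 < v i" if "i \<in> I" for i
    using rR[OF IQ[OF that]] vI[OF that] s by auto
  define E where "E = (\<Sum>i\<in>I. (3 * R i / v i) ^ ?n)"
  have E: "E \<le> (2 * (18 * A) ^ ?n + 1) * T"
  proof -
    \<comment> \<open>For these balls the images contain disjoint balls of radius
      \<open>R i / A\<close>, so \<open>sum_shells_le\<close> applies in the image.\<close>
    define I1 where "I1 = {i \<in> I. ball (F i) (R i / A) \<subseteq> F ` ball i (r i)}"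
    have "disjoint_family_on (\<lambda>i. ball (F i) (R i / A)) I1"
      unfolding disjoint_family_on_def
    proof (intro ballI impI)
      fix i j assume ij: "i \<in> I1" "j \<in> I1" "i \<noteq> j"
      then have "F ` ball i (r i) \<inter> F ` ball j (r j) = {}"
        using disj unfolding disjoint_family_on_def I1_def
        by (metis (no_types, lifting) image_Int[OF inj] image_empty mem_Collect_eq)
      then show "ball (F i) (R i / A) \<inter> ball (F j) (R j / A) = {}"
        using ij by (auto simp: I1_def)
    qed
    then have E1: "(\<Sum>i\<in>I1. (3 * R i / v i) ^ ?n) \<le> (T + 1) * (18 * A) ^ ?n"
      unfolding T_def v_def using \<open>finite I\<close> A1 s st vI Rv
      by (intro sum_shells_le) (auto simp: I1_def v_def)
    have "(\<Sum>i\<in>I - I1. (3 * R i / v i) ^ ?n) \<le> (\<Sum>i\<in>I - I1. (r i / (10 * a)) ^ ?n)"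
    proof (intro sum_mono power_mono)
      fix i assume i: "i \<in> I - I1"
      then have "R i \<le> \<epsilon> * r i" using rR[OF IQ[of i]] by (auto simp: I1_def)
      have "3 * R i / v i \<le> 3 * R i / s"
        using vI[of i] Rv[of i] s i by (intro divide_left_mono) auto
      also have "\<dots> \<le> 3 * (\<epsilon> * r i) / s"
        using \<open>R i \<le> \<epsilon> * r i\<close> s by (intro divide_right_mono) auto
      also have "\<dots> = r i / (10 * a)" using s a by (simp add: \<epsilon>_def)
      finally show "3 * R i / v i \<le> r i / (10 * a)" .
      show "0 \<le> 3 * R i / v i" using Rv[of i] i by auto
    qed
    also have "\<dots> \<le> (\<Sum>i\<in>I. (r i / (10 * a)) ^ ?n)"
      using \<open>finite I\<close> a rR IQ by (intro sum_mono2) (auto intro!: less_imp_le divide_pos_pos)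
    also have "\<dots> = (\<Sum>i\<in>I. r i ^ ?n) / (10 * a) ^ ?n"
      by (simp only: power_divide sum_divide_distrib)
    also have "\<dots> \<le> (10 * a) ^ ?n / (10 * a) ^ ?n"
    proof (rule divide_right_mono)
      have "ball i (r i) \<subseteq> ball z (10 * a)" if "i \<in> I" for i
      proof
        fix u assume "u \<in> ball i (r i)"
        then show "u \<in> ball z (10 * a)"
          using dist_triangle[of z u i] IQ[OF that] rR[OF IQ[OF that]] a by (auto simp: Q_def W_def)
      qed
      then show "(\<Sum>i\<in>I. r i ^ ?n) \<le> (10 * a) ^ ?n"
        using \<open>finite I\<close> rR IQ a disj by (intro sum_pow_radii_le) (auto intro: less_imp_le)
    qed (use a in simp)
    also have "\<dots> = 1" using a by simp
    finally have E2: "(\<Sum>i\<in>I - I1. (3 * R i / v i) ^ ?n) \<le> 1" .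
    have "E = (\<Sum>i\<in>I - I1. (3 * R i / v i) ^ ?n) + (\<Sum>i\<in>I1. (3 * R i / v i) ^ ?n)"
      unfolding E_def using \<open>finite I\<close> by (intro sum.subset_diff) (auto simp: I1_def)
    also have "\<dots> \<le> T + (T + T) * (18 * A) ^ ?n"
    proof (rule add_mono)
      have "(T + 1) * (18 * A) ^ ?n \<le> (T + T) * (18 * A) ^ ?n"
        using T1 A1 by (intro mult_right_mono) auto
      then show "(\<Sum>i\<in>I1. (3 * R i / v i) ^ ?n) \<le> (T + T) * (18 * A) ^ ?n" using E1 by (rule order.trans[rotated])
    qed (use E2 T1 in simp)
    also have "\<dots> = (2 * (18 * A) ^ ?n + 1) * T" by (simp add: distrib_right)
    finally show ?thesis .
  qed
  define c where "c = 2 * (18 * A) ^ ?n + 1"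
  define c1 :: real where "c1 = 960 ^ ?n * 4 * (2 * 2 ^ ?n) ^ ?n"
  define c2 :: real where "c2 = 960 ^ ?n * 240"
  define \<Lambda> where "\<Lambda> = max 1 (2 * c2 * c)"
  have c0: "0 < c" "0 < c2" using A1 by (auto simp: c_def c2_def intro: add_nonneg_pos)
  have L1: "1 \<le> \<Lambda>" "2 * c2 * c \<le> \<Lambda>" by (auto simp: \<Lambda>_def)
  have "T \<le> 960 ^ ?n * 4 * (\<Lambda> * (2 * 2 ^ ?n) ^ ?n + 60 * E / \<Lambda> ^ (?n - 1))"
    unfolding T_def E_def
  proof (rule ln_ratio_le_of_covering[where v = v and x = "\<lambda>i. i" and r = r and z = z and a = a])
    show "\<exists>p\<in>sphere z \<rho>. v p \<le> s" "\<exists>q\<in>sphere z \<rho>. t \<le> v q" if "\<rho> \<in> {a..2 * a}" for \<rho>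
      using small[OF that] large[OF that] by (auto simp: v_def)
    show "\<exists>i\<in>I. y \<in> ball i (5 * r i) \<and> \<bar>v y - v i\<bar> \<le> R i"
      if "a / 2 \<le> dist z y" "dist z y \<le> 3 * a" "s \<le> v y" "v y \<le> t" for y
    proof -
      have "y \<in> Q" using that by (simp add: Q_def W_def)
      then obtain i where i: "i \<in> Y" "y \<in> ball i (r i)" using Y by blast
      obtain j where j: "j \<in> I" "cball i (r i) \<subseteq> ball j (5 * r j)" using I(3)[OF i(1)] by blast
      have y: "y \<in> ball j (5 * r j)" using i j by (auto simp: subset_eq)
      then have "F y \<in> cball (F j) (R j)"
        using rR[OF IQ[OF j(1)]] by (auto simp: image_subset_iff)
      then have "\<bar>v y - v j\<bar> \<le> R j"
        using abs_dist_diff_le[of "F y" z' "F j"] by (simp add: v_def dist_commute)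
      then show ?thesis using j y by blast
    qed
    show "dist z i \<le> 3 * a" if "i \<in> I" for i using IQ[OF that] by (auto simp: Q_def W_def)
    show "0 < r i \<and> r i \<le> a" if "i \<in> I" for i using rR[OF IQ[OF that]] by blast
  qed (use n2 a s st \<open>finite I\<close> disj Rv contv L1 in auto)
  also have "\<dots> = c1 * \<Lambda> + c2 * (E / \<Lambda> ^ (?n - 1))"
    unfolding c1_def c2_def distrib_left by simp
  also have "\<dots> \<le> c1 * \<Lambda> + c2 * (c * T / \<Lambda>)"
  proof (intro add_left_mono mult_left_mono frac_le)
    \<comment> \<open>In dimension at least two the exponent is at least \<open>1\<close>, so a
      large \<open>\<Lambda>\<close> makes the energy term small compared with
      \<open>T\<close>.\<close>
    have "\<Lambda> ^ 1 \<le> \<Lambda> ^ (?n - 1)" using L1 n2 by (intro power_increasing) auto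
    then show "\<Lambda> \<le> \<Lambda> ^ (?n - 1)" by simp
    show "E \<le> c * T" using E by (simp add: c_def)
  qed (use c0 T1 L1 in auto)
  also have "c2 * (c * T / \<Lambda>) \<le> T / 2"
    using mult_right_mono[OF L1(2), of T] T1 L1(1) by (simp add: field_simps)
  finally have "T \<le> 2 * c1 * \<Lambda>" by simp
  then have "T \<le> max 1 (2 * c1 * \<Lambda>)" by simp
  then have "exp T \<le> ring_const ?n K"
    unfolding ring_const_def Let_def c1_def c2_def \<Lambda>_def c_def A_def by simp
  moreover have "exp T = t / s" using s st by (simp add: T_def)
  ultimately show ?thesis using s by (simp add: divide_le_eq)
qed


subsection \<open>Uniformly perfect boundaries\<close>

lemma uniformly_perfect_spherical_dest:
  assumes "uniformly_perfect C X spherical_dist" and p: "p \<in> X" and "0 < r"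
    and o: "q \<in> X" "r \<le> spherical_dist p q"
  obtains u where "u \<in> X" "spherical_dist p u < r" "r / C \<le> spherical_dist p u"
proof -
  interpret Metric_space X spherical_dist
    by (rule Metric_space.subspace[OF Metric_space_spherical]) simp
  have "X - mball p r \<noteq> {}" using o by auto
  then have "mball p r - mball p (r / C) \<noteq> {}"
    using assms(1) p \<open>0 < r\<close> unfolding uniformly_perfect_def by blast
  then show ?thesis using that by force
qed

text \<open>Neighbourhoods of infinity have compact complement, which cannot contain an unbounded
  set.\<close>

lemma None_in_sphere_boundary:
  assumes "\<not> bounded (D :: 'a::euclidean_space set)"
  shows "None \<in> sphere_boundary D"
proof -
  have "None \<in> riemann_sphere closure_of (Some ` D)"
    unfolding in_closure_of
  proof (intro conjI allI impI)
    fix V :: "'a option set"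
    assume "None \<in> V \<and> openin riemann_sphere V"
    then obtain k where "compact k" "V = insert None (Some ` (UNIV - k))"
      unfolding openin_Alexandroff_compactification by auto
    moreover obtain x where "x \<in> D" "x \<notin> k"
      using assms \<open>compact k\<close> compact_imp_bounded bounded_subset by blast
    ultimately show "\<exists>y. y \<in> Some ` D \<and> y \<in> V" by blast
  qed simp
  moreover have "None \<notin> riemann_sphere interior_of (Some ` D)"
    using interior_of_subset[of riemann_sphere "Some ` D"] by blast
  ultimately show ?thesis by (simp add: sphere_boundary_def frontier_of_def)
qed

lemma abs_sqrt_one_plus_diff_le:
  fixes w z :: "'a::euclidean_space"
  shows "\<bar>sqrt (1 + (norm w)\<^sup>2) - sqrt (1 + (norm z)\<^sup>2)\<bar> \<le> dist z w"
proof -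
  have *: "sqrt (1 + (norm u)\<^sup>2) = norm (u, 1::real)" for u :: 'a
    by (simp add: norm_Pair add.commute)
  show ?thesis
    unfolding * dist_norm norm_minus_commute[of z]
    using norm_triangle_ineq3[of "(w, 1::real)" "(z, 1)"] by (simp add: norm_Pair)
qed

text \<open>A round ring around \<open>z\<close> that misses the complement of \<open>D\<close> separates the spherical boundary.
  If the ring is thick on the part below the scale \<open>sqrt (1 + (norm z)\<^sup>2)\<close>, spherical and Euclidean
  distances from \<open>z\<close> are comparable there and \<open>z\<close> is a bad centre; otherwise it is thick above
  that scale and a boundary point outside the ring, close to infinity, is a bad centre.\<close>

lemma uniformly_perfect_ring_meets_complement:
  fixes D :: "'a::euclidean_space set"
  assumes C: "1 < C" and D: "open D"
    and up: "uniformly_perfect C (sphere_boundary D) spherical_dist"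
    and z: "z \<in> frontier D" and R: "0 < R"
  obtains w where "w \<notin> D" "R \<le> dist z w" "dist z w \<le> (25 * C)\<^sup>2 * R"
proof (rule ccontr)
  assume "\<not> thesis"
  with that have ring: "w \<in> D" if "R \<le> dist z w" "dist z w \<le> (25 * C)\<^sup>2 * R" for w
    using \<open>R \<le> dist z w\<close> \<open>dist z w \<le> (25 * C)\<^sup>2 * R\<close> by blast
  define B where "B = 25 * C"
  note ring = ring[folded B_def]
  have B: "25 < B" using C by (simp add: B_def)
  have BR: "B * R \<le> B\<^sup>2 * R" "R \<le> B * R"
    using B R by (auto simp: power2_eq_square)
  define X where "X = sphere_boundary D"
  have fin: "Some w \<in> X \<longleftrightarrow> w \<in> frontier D" for w
    using finite_sphere_boundary[of D] by (auto simp: X_def)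
  have notD: "w \<notin> D" if "w \<in> frontier D" for w
    using that D by (simp add: frontier_def interior_open)
  \<comment> \<open>\<open>None\<close> satisfies this vacuously. By \<open>ring\<close>, every
    other point of \<open>X\<close> that fails it is finite and closer to \<open>z\<close> than
    \<open>R\<close>.\<close>
  define out where "out u \<longleftrightarrow> (\<forall>w. u = Some w \<longrightarrow> B\<^sup>2 * R < dist z w)" for u
  have inner: "\<exists>w. u = Some w \<and> dist z w < R" if u: "u \<in> X" "\<not> out u" for u
  proof -
    obtain w where w: "u = Some w" "\<not> B\<^sup>2 * R < dist z w" using u by (auto simp: out_def)
    then have "w \<notin> D" using u fin notD by auto
    then have "\<not> R \<le> dist z w" using w ring[of w] by auto
    then show ?thesis using w by simp
  qed
  obtain u\<^sub>0 where u0: "u\<^sub>0 \<in> X" "out u\<^sub>0"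
  proof (cases "bounded D")
    case False
    then show ?thesis using that[of None] None_in_sphere_boundary[OF False] by (simp add: X_def out_def)
  next
    case True
    obtain e :: 'a where e: "norm e = 1" using vector_choose_size[of 1] by auto
    \<comment> \<open>A ray that starts inside the ring, hence in \<open>D\<close>, must leave the
      bounded set \<open>D\<close>, and can do so only beyond the ring.\<close>
    define H where "H = (\<lambda>\<tau>. z + \<tau> *\<^sub>R e) ` {R..}"
    have dH: "dist z (z + \<tau> *\<^sub>R e) = \<bar>\<tau>\<bar>" for \<tau> using e by (simp add: dist_norm)
    have "connected H" unfolding H_def
      by (intro connected_continuous_image continuous_intros) simp
    moreover have "z + R *\<^sub>R e \<in> H \<inter> D"
      using R dH[of R] BR B by (auto simp: H_def intro!: ring)
    moreover have "H - D \<noteq> {}"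
    proof -
      obtain r where r: "\<And>u. u \<in> D \<Longrightarrow> dist z u \<le> r" using True by (auto simp: bounded_any_center[of _ z])
      have "z + (max R (r + 1)) *\<^sub>R e \<in> H" unfolding H_def by (rule imageI) simp
      moreover have "z + (max R (r + 1)) *\<^sub>R e \<notin> D" using r dH[of "max R (r + 1)"] R by fastforce
      ultimately show ?thesis by blast
    qed
    ultimately obtain w where w: "w \<in> H" "w \<in> frontier D"
      using connected_Int_frontier[of H D] by blast
    then have "R \<le> dist z w" using dH R by (auto simp: H_def)
    then have "out (Some w)" using ring[of w] notD[OF w(2)] not_le by (auto simp: out_def)
    then show ?thesis using that w fin by blast
  qed
  define g where "g w = sqrt (1 + (norm w)\<^sup>2)" for w :: 'a
  define q where "q = g z"
  have g1: "1 \<le> g w" "norm w \<le> g w" for w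
    unfolding g_def by (auto intro: real_le_rsqrt)
  have q0: "0 < q" using g1[of z] by (simp add: q_def)
  have gq: "g w \<le> q + dist z w" "q - dist z w \<le> g w" for w
    using abs_sqrt_one_plus_diff_le[of w z] unfolding q_def g_def by linarith+
  have zX: "Some z \<in> X" using z fin by simp
  note up' = uniformly_perfect_spherical_dest[OF up[folded X_def]]
  show False
  proof (cases "B * R \<le> q / 2")
    case True
    \<comment> \<open>A lower bound for the chordal distance
      \<open>2 * B * R / (q * (q + B * R))\<close>, using \<open>q + B * R \<le> 3 * q / 2\<close>.
      Boundary points inside the ring are within \<open>4 * R / q\<^sup>2\<close> of
      \<open>z\<close>, which is less than \<open>r / C\<close>.\<close>
    define r where "r = 4 * (B * R) / (3 * q\<^sup>2)"
    have r0: "0 < r" using B R q0 by (simp add: r_def)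
    have far: "r \<le> spherical_dist (Some z) u" if "out u" for u
    proof (cases u)
      case None
      have "r \<le> 4 * (q / 2) / (3 * q\<^sup>2)"
        unfolding r_def using True q0 by (intro divide_right_mono mult_left_mono) auto
      also have "\<dots> \<le> 2 / q" using q0 by (simp add: power2_eq_square field_simps)
      finally show ?thesis by (simp add: None spherical_dist_formula q_def g_def)
    next
      case (Some w)
      define \<rho> where "\<rho> = dist z w"
      have \<rho>: "B * R \<le> \<rho>" using that BR by (auto simp: Some out_def \<rho>_def)
      have gp: "0 < g w" using g1[of w] by simp
      have "4 * (B * R) * g w \<le> 4 * (B * R) * (q + \<rho>)"
        using gq(1)[of w] B R by (intro mult_left_mono) (auto simp: \<rho>_def)
      also have "\<dots> = 4 * (B * R) * q + 4 * (B * R) * \<rho>" by (simp add: distrib_left)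
      also have "\<dots> \<le> 4 * \<rho> * q + 4 * (q / 2) * \<rho>"
        using \<rho> True q0 B R by (intro add_mono mult_right_mono mult_left_mono) (auto simp: \<rho>_def)
      also have "\<dots> = 6 * \<rho> * q" by simp
      finally have "r \<le> 2 * \<rho> / (q * g w)"
        using q0 gp by (simp add: r_def field_simps power2_eq_square)
      then show ?thesis
        by (simp add: Some spherical_dist_formula \<rho>_def q_def g_def dist_norm)
    qed
    obtain u where u: "u \<in> X" "spherical_dist (Some z) u < r" "r / C \<le> spherical_dist (Some z) u"
      by (rule up'[OF zX r0 u0(1) far[OF u0(2)]])
    have "\<not> out u" using far[of u] u(2) by linarith
    then obtain w where w: "u = Some w" "dist z w < R" using inner[OF u(1)] by blast
    have gw: "q / 2 \<le> g w" using gq(2)[of w] w True BR by linarith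
    have "spherical_dist (Some z) u = 2 * dist z w / (q * g w)"
      by (simp add: w spherical_dist_formula q_def g_def dist_norm)
    also have "\<dots> \<le> 2 * R / (q * (q / 2))"
      using w gw q0 R by (intro frac_le mult_left_mono) auto
    also have "\<dots> = 4 * R / q\<^sup>2" by (simp add: power2_eq_square)
    also have "\<dots> < r / C"
      using q0 R C by (simp add: r_def B_def field_simps)
    finally show False using u by simp
  next
    case False
    \<comment> \<open>Points inside the ring are at least \<open>2 / (3 * (B * R))\<close> from
      infinity and \<open>out\<close> points at most \<open>4 / (B\<^sup>2 * R)\<close>, which is at
      most half of that; the difference is at least \<open>r\<close>.\<close>
    define r where "r = 1 / (3 * (B * R))"
    have r0: "0 < r" using B R by (simp add: r_def)
    have near: "spherical_dist u None \<le> 4 / (B\<^sup>2 * R)" if "out u" for u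
    proof (cases u)
      case None then show ?thesis using B R by (simp add: spherical_dist_def)
    next
      case (Some w)
      have "4 * (B * R) \<le> B * (B * R)" using B R by (intro mult_right_mono) auto
      then have "4 * (B * R) \<le> B\<^sup>2 * R" by (simp add: power2_eq_square)
      moreover have "B\<^sup>2 * R < dist z w" using that by (simp add: Some out_def)
      moreover have "dist z w \<le> norm z + norm w" by (simp add: dist_norm norm_triangle_ineq4)
      ultimately have gw: "B\<^sup>2 * R / 2 \<le> g w"
        using g1(2)[of w] g1(2)[of z] False unfolding q_def by linarith
      have "2 / g w \<le> 2 / (B\<^sup>2 * R / 2)" using gw B R by (intro divide_left_mono) (auto intro!: mult_pos_pos order.strict_trans2[OF _ gw])
      then show ?thesis by (simp add: Some spherical_dist_formula g_def)
    qed
    have far: "r \<le> spherical_dist u (Some w)" if "out u" "dist z w < R" for u w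
    proof -
      have "g w \<le> 3 * (B * R)" using gq(1)[of w] that False BR by linarith
      then have "2 / (3 * (B * R)) \<le> 2 / g w" using g1(1)[of w] B R by (intro divide_left_mono) auto
      also have "\<dots> = spherical_dist (Some w) None" by (simp add: spherical_dist_formula g_def)
      also have "\<dots> \<le> spherical_dist u (Some w) + spherical_dist u None"
        unfolding spherical_dist_def by (rule dist_triangle3)
      also have "\<dots> \<le> spherical_dist u (Some w) + 4 / (B\<^sup>2 * R)" using near[OF that(1)] by simp
      also have "4 / (B\<^sup>2 * R) \<le> r"
        using B R by (simp add: r_def field_simps power2_eq_square)
      finally show ?thesis by (simp add: r_def)
    qed
    have zr: "r \<le> spherical_dist u\<^sub>0 (Some z)" using far[OF u0(2), of z] R by simp
    obtain u where u: "u \<in> X" "spherical_dist u\<^sub>0 u < r" "r / C \<le> spherical_dist u\<^sub>0 u"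
      by (rule up'[OF u0(1) r0 zX zr])
    have "out u"
    proof (rule ccontr)
      assume "\<not> out u"
      then obtain w where w: "u = Some w" "dist z w < R" using inner[OF u(1)] by blast
      then show False using far[OF u0(2) w(2)] u(2) by simp
    qed
    have "spherical_dist u\<^sub>0 u \<le> spherical_dist u\<^sub>0 None + spherical_dist u None"
      unfolding spherical_dist_def by (rule dist_triangle2)
    also have "\<dots> \<le> 4 / (B\<^sup>2 * R) + 4 / (B\<^sup>2 * R)" by (intro add_mono near u0 \<open>out u\<close>)
    \<comment> \<open>The inequality \<open>8 / (B\<^sup>2 * R) < 1 / (3 * C * B * R)\<close>
      amounts to \<open>24 * C < B\<close>, whence the constant \<open>25\<close>.\<close>
    also have "\<dots> < r / C"
      using C R by (simp add: r_def B_def field_simps power2_eq_square)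
    finally show False using u by simp
  qed
qed

subsection \<open>Extension by the identity\<close>

lemma open_vimage_Some:
  assumes "openin riemann_sphere V"
  shows "open (Some -` V :: 'a::euclidean_space set)"
  using assms unfolding openin_Alexandroff_compactification
  by (auto simp: vimage_def image_iff open_Compl closed_def Compl_eq)

text \<open>The values of \<open>f\<close> off the closure of \<open>D\<close> are arbitrary and are
  replaced here; on the finite boundary \<open>f\<close> is already the identity, so the pieces
  fit.\<close>

definition extend_by_identity ::
    "'a::euclidean_space set \<Rightarrow> ('a option \<Rightarrow> 'a option) \<Rightarrow> 'a \<Rightarrow> 'a" where
  "extend_by_identity D f x = (if x \<in> D then finite_part f x else x)"

text \<open>Continuity is obtained by pasting over the closed sets \<open>closure D\<close> and
  \<open>- D\<close>. Bijectivity follows from that of \<open>f\<close> because boundary points are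
  fixed, and invariance of domain supplies the continuous inverse.\<close>

lemma extend_by_identity:
  fixes D :: "'a::euclidean_space set"
  assumes D: "open D" and f: "f \<in> qc_identity_boundary K D"
  defines "F \<equiv> extend_by_identity D f"
  shows "\<exists>G. homeomorphism UNIV UNIV F G" (is ?hom) and "F ` D \<subseteq> D"
    and "x \<in> D \<Longrightarrow> linear_dilatation F x \<le> ereal K"
proof -
  define S where "S = sphere_closure D"
  have hom: "homeomorphic_map (subtopology riemann_sphere S) (subtopology riemann_sphere S) f"
    and fin: "\<And>x. x \<in> D \<Longrightarrow> f (Some x) \<noteq> None" and qc: "quasiconformal K D (finite_part f ` D) (finite_part f)"
    and bd: "\<And>p. p \<in> sphere_boundary D \<Longrightarrow> f p = p"
    using f by (auto simp: qc_identity_boundary_def S_def)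
  have top: "topspace (subtopology riemann_sphere S) = S"
    by (auto simp: S_def sphere_closure_def closure_of_def)
  have img: "f ` S = S" and inj: "inj_on f S"
    using hom unfolding homeomorphic_eq_everything_map top by auto
  have cmap: "continuous_map (subtopology riemann_sphere S) (subtopology riemann_sphere S) f"
    using hom by (rule homeomorphic_imp_continuous_map)
  have SD: "Some x \<in> S \<longleftrightarrow> x \<in> closure D" for x
    by (simp add: S_def sphere_closure_def Some_in_closure_of_iff) (simp add: vimage_def image_iff)
  have fr: "Some x \<in> sphere_boundary D \<longleftrightarrow> x \<in> frontier D" for x
    using finite_sphere_boundary[of D] by auto
  have fro: "frontier D = closure D - D" using D by (simp add: frontier_def interior_open)
  have bdS: "sphere_boundary D \<subseteq> S"
    by (auto simp: sphere_boundary_def S_def sphere_closure_def frontier_of_def)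
  have None_bd: "None \<in> sphere_boundary D" if "None \<in> S"
    using that interior_of_subset[of riemann_sphere "Some ` D"]
    by (auto simp: sphere_boundary_def S_def sphere_closure_def frontier_of_def)
  have fF: "f (Some x) = Some (F x)" if "x \<in> closure D" for x
    using that fin[of x] bd[of "Some x"] fr[of x] fro
    by (auto simp: F_def extend_by_identity_def finite_part_def)
  \<comment> \<open>A point of \<open>D\<close> sent to the boundary would share its image with that
    fixed boundary point, against injectivity.\<close>
  have FD: "F x \<in> D" if x: "x \<in> D" for x
  proof (rule ccontr)
    assume no: "F x \<notin> D"
    have xS: "x \<in> closure D" using x closure_subset by blast
    then have "Some (F x) \<in> S" using img SD fF by (metis imageI)
    then have b: "Some (F x) \<in> sphere_boundary D" using no SD fr fro by blast
    then have "f (Some (F x)) = f (Some x)" using bd fF[OF xS] by simp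
    then have "F x = x" using inj b bdS xS SD unfolding inj_on_def by blast
    then show False using no x by simp
  qed
  then show "F ` D \<subseteq> D" by blast
  have out: "F x = x" if "x \<notin> D" for x using that by (simp add: F_def extend_by_identity_def)
  have "continuous_on (closure D) F"
    unfolding continuous_openin_preimage_eq
  proof (intro allI impI)
    fix U :: "'a set" assume "open U"
    then have "openin riemann_sphere (Some ` U)"
      by (auto simp: openin_Alexandroff_compactification)
    then have "openin (subtopology riemann_sphere S) (Some ` U \<inter> S)"
      unfolding openin_subtopology by blast
    then have "openin (subtopology riemann_sphere S) {p \<in> S. f p \<in> Some ` U \<inter> S}"
      using openin_continuous_map_preimage[OF cmap] unfolding top by blast
    then obtain V where V: "openin riemann_sphere V" "{p \<in> S. f p \<in> Some ` U \<inter> S} = V \<inter> S"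
      unfolding openin_subtopology by blast
    have "closure D \<inter> F -` U = closure D \<inter> Some -` V"
    proof -
      have "F x \<in> U \<longleftrightarrow> Some x \<in> V" if "x \<in> closure D" for x
      proof -
        have "Some x \<in> V \<inter> S \<longleftrightarrow> f (Some x) \<in> Some ` U \<inter> S"
          unfolding V(2)[symmetric] using that SD by blast
        moreover have "Some x \<in> S" using that SD by blast
        moreover from this have "f (Some x) \<in> S" using img by blast
        ultimately show ?thesis using fF[OF that] by auto
      qed
      then show ?thesis by blast
    qed
    then show "openin (top_of_set (closure D)) (closure D \<inter> F -` U)"
      using open_vimage_Some[OF V(1)] by (metis openin_open_Int)
  qed
  moreover have "continuous_on (- D) F"
    using out by (subst continuous_on_cong[where g = "\<lambda>x. x"]) auto
  ultimately have "continuous_on (closure D \<union> - D) F"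
    using D by (intro continuous_on_closed_Un) (auto simp: closed_Compl)
  moreover have "closure D \<union> - D = UNIV" using closure_subset by blast
  ultimately have cont: "continuous_on UNIV F" by simp
  have "inj F"
  proof (rule injI)
    fix x y assume eq: "F x = F y"
    have "x \<in> D \<longleftrightarrow> y \<in> D" using FD out eq by metis
    moreover have "x = y" if "x \<in> D" "y \<in> D"
    proof -
      have "x \<in> closure D" "y \<in> closure D" using that closure_subset by blast+
      then have "f (Some x) = f (Some y)" "Some x \<in> S" "Some y \<in> S" using eq fF SD by simp_all
      then show ?thesis using inj unfolding inj_on_def by blast
    qed
    ultimately show "x = y" using out eq by metis
  qed
  have "surj F"
    unfolding surj_def
  proof
    fix y show "\<exists>x. y = F x"
    proof (cases "y \<in> D")
      case False then show ?thesis using out by metis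
    next
      case True
      then have "Some y \<in> f ` S" unfolding img SD using closure_subset by blast
      then obtain p where p: "p \<in> S" "Some y = f p" by blast
      \<comment> \<open>Infinity, if it lies in the closure, is a boundary point and therefore
        fixed.\<close>
      have "p \<noteq> None"
      proof
        assume "p = None"
        then have "f None = None" using p bd None_bd by blast
        then show False using p \<open>p = None\<close> by simp
      qed
      then obtain x where "p = Some x" by blast
      then show ?thesis using p SD fF by auto
    qed
  qed
  then show ?hom
    using invariance_of_domain_homeomorphism[OF open_UNIV cont _ \<open>inj F\<close>] by auto
  assume x: "x \<in> D"
  then obtain e where e: "e > 0" "ball x e \<subseteq> D" using D open_contains_ball by blast
  have eq: "F y = finite_part f y" if "y \<in> D" for y using that by (simp add: F_def extend_by_identity_def)
  \<comment> \<open>Spheres of radius below \<open>e\<close> lie in \<open>D\<close>, where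
    \<open>F\<close> and \<open>finite_part f\<close> agree, so the two limits coincide.\<close>
  have "\<forall>\<^sub>F r in at_right 0. 0 < r \<and> r < e"
    using e by (auto simp: eventually_at_right_field intro!: exI[of _ e])
  then have "\<forall>\<^sub>F r in at_right 0.
      ereal ((SUP y\<in>sphere x r. norm (F x - F y)) / (INF z\<in>sphere x r. norm (F x - F z)))
    = ereal ((SUP y\<in>sphere x r. norm (finite_part f x - finite_part f y))
        / (INF z\<in>sphere x r. norm (finite_part f x - finite_part f z)))"
  proof (eventually_elim)
    case (elim r)
    then have "sphere x r \<subseteq> D" using e by (auto simp: subset_eq)
    then have "norm (F x - F y) = norm (finite_part f x - finite_part f y)" if "y \<in> sphere x r" for y
      using that x eq by auto
    then show ?case by simp
  qed
  then have "linear_dilatation F x = Limsup (at_right 0)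
      (\<lambda>r. ereal ((SUP y\<in>sphere x r. norm (finite_part f x - finite_part f y))
        / (INF z\<in>sphere x r. norm (finite_part f x - finite_part f z))))"
    unfolding linear_dilatation_def by (rule Limsup_eq)
  also have "\<dots> \<le> ereal K" using qc x by (simp add: quasiconformal_def)
  finally show "linear_dilatation F x \<le> ereal K" .
qed

section \<open>Values attained on concentric spheres\<close>

text \<open>The preimage of the ball is connected and contains \<open>z\<close> and
  \<open>w\<close>, so \<open>dist z\<close> takes on it every value up to
  \<open>dist z w\<close>.\<close>

lemma sphere_meets_preimage_cball:
  fixes F :: "'a::euclidean_space \<Rightarrow> 'a"
  assumes F: "homeomorphism UNIV UNIV F G"
    and z: "dist z' (F z) \<le> s" and w: "dist z' (F w) \<le> s" and \<rho>: "0 \<le> \<rho>" "\<rho> \<le> dist z w"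
  shows "\<exists>p\<in>sphere z \<rho>. dist z' (F p) \<le> s"
proof -
  have GF: "G (F y) = y" "F (G y) = y" for y using F by (auto simp: homeomorphism_def)
  have "connected (G ` cball z' s)"
    using F by (intro connected_continuous_image) (auto simp: homeomorphism_def intro: continuous_on_subset)
  then have "connected (dist z ` G ` cball z' s)"
    by (rule connected_continuous_image[rotated]) (intro continuous_intros)
  moreover have "dist z z \<in> dist z ` G ` cball z' s" "dist z w \<in> dist z ` G ` cball z' s"
    using GF(1)[of z] GF(1)[of w] z w by (metis imageI mem_cball)+
  ultimately have "\<rho> \<in> dist z ` G ` cball z' s"
    using \<rho> unfolding connected_iff_interval by (metis dist_self)
  then obtain q where "q \<in> cball z' s" "\<rho> = dist z (G q)" by blast
  then show ?thesis using GF(2)[of q] by (intro bexI[of _ "G q"]) auto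
qed

text \<open>In dimension at least two the complement of a ball is connected. Its preimage contains
  \<open>w\<close> and, as \<open>F\<close> maps \<open>cball z \<rho>\<close> to a bounded set,
  also a point at distance at least \<open>\<rho>\<close> from \<open>z\<close>.\<close>

lemma sphere_meets_preimage_Compl_ball:
  fixes F :: "'a::euclidean_space \<Rightarrow> 'a"
  assumes n2: "2 \<le> DIM('a)" and F: "homeomorphism UNIV UNIV F G"
    and w: "t \<le> dist z' (F w)" and \<rho>: "dist z w \<le> \<rho>"
  shows "\<exists>q\<in>sphere z \<rho>. t \<le> dist z' (F q)"
proof -
  let ?S = "- ball z' t"
  have GF: "G (F y) = y" "F (G y) = y" for y using F by (auto simp: homeomorphism_def)
  have "connected ?S"
    using n2 by (intro path_connected_imp_connected path_connected_complement_bounded_convex) auto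
  then have "connected (G ` ?S)"
    using F by (intro connected_continuous_image) (auto simp: homeomorphism_def intro: continuous_on_subset)
  then have conn: "connected (dist z ` G ` ?S)"
    by (rule connected_continuous_image[rotated]) (intro continuous_intros)
  have "compact (F ` cball z \<rho>)"
    using F by (intro compact_continuous_image) (auto simp: homeomorphism_def intro: continuous_on_subset)
  then have "bounded (F ` cball z \<rho> \<union> ball z' t)" by (simp add: compact_imp_bounded)
  then obtain q where q: "q \<notin> F ` cball z \<rho>" "q \<in> ?S"
    using not_bounded_UNIV[where 'a='a] by (metis UNIV_eq_I UnCI ComplI)
  have "\<rho> \<le> dist z (G q)" using q(1) GF(2)[of q] by (metis imageI linear mem_cball)
  moreover have "dist z (G (F w)) \<in> dist z ` G ` ?S" "dist z (G q) \<in> dist z ` G ` ?S"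
    using w q(2) by (intro imageI; simp)+
  ultimately have "\<rho> \<in> dist z ` G ` ?S"
    using \<rho> conn unfolding connected_iff_interval GF(1) by blast
  then obtain p where "p \<in> ?S" "\<rho> = dist z (G p)" by blast
  then show ?thesis using GF(2)[of p] by (intro bexI[of _ "G p"]) auto
qed

section \<open>Distortion relative to a boundary point\<close>

text \<open>The ring estimate is used twice with \<open>z' = z\<close>: a fixed point
  \<open>w\<close> beyond the ring bounds \<open>dist y z\<close> in terms of
  \<open>dist x z\<close>, and one inside the ring gives the converse. The triangle inequality adds
  the \<open>1\<close> in \<open>N\<close>.\<close>

proposition dist_qc_identity_boundary_le:
  fixes D :: "'a::euclidean_space set"
  assumes n2: "2 \<le> DIM('a)" and C: "1 < C" and K: "0 \<le> K"
    and D: "open D" and up: "uniformly_perfect C (sphere_boundary D) spherical_dist"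
    and f: "f \<in> qc_identity_boundary K D" and x: "x \<in> D"
  defines "y \<equiv> finite_part f x"
    and "N \<equiv> 1 + ring_const (DIM('a)) K * (4 + 6 * (25 * C)\<^sup>2)"
  shows "\<And>z. z \<in> frontier D \<Longrightarrow> dist x y \<le> N * dist x z"
    and "\<And>z. z \<in> frontier D \<Longrightarrow> dist x y \<le> N * dist y z"
    and "y \<in> D"
proof -
  define F where "F = extend_by_identity D f"
  define H where "H = ring_const (DIM('a)) K"
  define B where "B = (25 * C)\<^sup>2"
  have N_eq: "N = 1 + H * (4 + 6 * B)" by (simp add: N_def H_def B_def)
  have H1: "1 \<le> H" by (simp add: H_def ring_const_ge_1)
  have B1: "1 \<le> B" unfolding B_def using C by (intro one_le_power) simp
  obtain G where G: "homeomorphism UNIV UNIV F G"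
    using extend_by_identity(1)[OF D f] by (auto simp: F_def)
  have dil: "linear_dilatation F p \<le> ereal K" if "p \<in> D" for p
    using extend_by_identity(3)[OF D f that] by (simp add: F_def)
  have out: "F p = p" if "p \<notin> D" for p using that by (simp add: F_def extend_by_identity_def)
  have Fx: "F x = y" using x by (simp add: F_def extend_by_identity_def y_def)
  show yD: "y \<in> D" using extend_by_identity(2)[OF D f] x Fx by (auto simp: F_def)
  fix z assume z: "z \<in> frontier D"
  have zD: "z \<notin> D" using z D by (simp add: frontier_def interior_open)
  have Fz: "F z = z" by (rule out[OF zD])
  show "dist x y \<le> N * dist x z"
  proof -
    define a where "a = dist z x"
    have a: "0 < a" using x zD by (auto simp: a_def)
    obtain w where w: "w \<notin> D" "2 * a \<le> dist z w" "dist z w \<le> B * (2 * a)"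
      using uniformly_perfect_ring_meets_complement[OF C D up z, of "2 * a"] a unfolding B_def by auto
    \<comment> \<open>With \<open>dist z w\<close> in the maximum, the preimage of
      \<open>cball z s\<close> joins \<open>z\<close> to \<open>w\<close> across the ring. With
      \<open>4 * a\<close>, fixed points of the ring have values at most \<open>3 * a < s\<close>,
      so \<open>dil\<close> is needed only in \<open>D\<close>.\<close>
    define s where "s = max (4 * a) (dist z w)"
    have "dist z y \<le> H * s"
      unfolding H_def
    proof (rule quasiconformal_ring_estimate[OF n2 G K a, of s z z])
      fix \<rho> assume \<rho>: "\<rho> \<in> {a..2 * a}"
      show "\<exists>p\<in>sphere z \<rho>. dist z (F p) \<le> s"
        using a w \<rho> by (intro sphere_meets_preimage_cball[OF G, of z z s w]) (auto simp: Fz out s_def)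
      show "\<exists>q\<in>sphere z \<rho>. dist z y \<le> dist z (F q)"
        using \<rho> by (intro sphere_meets_preimage_Compl_ball[OF n2 G, of _ z x]) (auto simp: Fx a_def)
    next
      fix p assume "dist z p \<le> 3 * a" "s \<le> dist z (F p)"
      then have "p \<in> D" using out[of p] a by (intro ccontr[of "p \<in> D"]) (auto simp: s_def)
      then show "linear_dilatation F p \<le> ereal K" by (rule dil)
    qed (use a in \<open>simp add: s_def\<close>)
    also have "\<dots> \<le> H * ((4 + 6 * B) * a)"
    proof (rule mult_left_mono)
      have "0 \<le> B * a" using a B1 by simp
      moreover have "dist z w \<le> 2 * (B * a)" using w(3) by (simp only: mult.left_commute)
      ultimately show "s \<le> (4 + 6 * B) * a" using a by (simp add: s_def distrib_right)
    qed (use H1 in simp)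
    finally show ?thesis
      using dist_triangle[of x y z] unfolding N_eq
      by (simp only: distrib_right[of 1] mult.assoc a_def dist_commute)
  qed
  show "dist x y \<le> N * dist y z"
  proof -
    define a where "a = dist z x / 2"
    define s where "s = dist z y"
    have a: "0 < a" and s: "0 < s" using x yD zD by (auto simp: a_def s_def)
    \<comment> \<open>This places \<open>w\<close> within \<open>a / 3\<close> of \<open>z\<close>,
      so fixed points of the ring, at distance at least \<open>a / 2\<close>, have values above
      \<open>dist z w\<close>.\<close>
    define R where "R = a / (3 * B)"
    have R: "0 < R" "B * R = a / 3" using a B1 by (auto simp: R_def)
    obtain w where w: "w \<notin> D" "R \<le> dist z w" "dist z w \<le> a / 3"
      using uniformly_perfect_ring_meets_complement[OF C D up z R(1)] R(2) unfolding B_def by metis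
    have "dist z w \<le> H * s"
      unfolding H_def
    proof (rule quasiconformal_ring_estimate[OF n2 G K a s, of z z])
      fix \<rho> assume \<rho>: "\<rho> \<in> {a..2 * a}"
      show "\<exists>p\<in>sphere z \<rho>. dist z (F p) \<le> s"
        using a s \<rho> by (intro sphere_meets_preimage_cball[OF G, of z z s x]) (auto simp: Fz Fx s_def a_def)
      show "\<exists>q\<in>sphere z \<rho>. dist z w \<le> dist z (F q)"
        using \<rho> w a by (intro sphere_meets_preimage_Compl_ball[OF n2 G, of _ z w]) (auto simp: out)
    next
      fix p assume "a / 2 \<le> dist z p" "dist z (F p) \<le> dist z w"
      then have "p \<in> D" using out[of p] a w(3) by (intro ccontr[of "p \<in> D"]) auto
      then show "linear_dilatation F p \<le> ereal K" by (rule dil)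
    qed
    then have "B * R \<le> B * (H * s)" using w(2) B1 by (intro mult_left_mono) auto
    then have "dist z x \<le> 6 * (B * (H * s))" using R(2) by (simp add: a_def)
    also have "\<dots> \<le> 6 * (B * (H * s)) + 4 * (H * s)" using H1 s by simp
    finally show ?thesis
      using dist_triangle[of x y z] unfolding N_eq by (simp add: s_def dist_commute algebra_simps)
  qed
qed

theorem theorem1p1:
  fixes C K :: real
  assumes "CARD('n::finite) \<ge> 2" and "C > 1" and "K \<ge> 1"
  shows "\<exists>M::real. \<forall>D :: (real ^ 'n) set.
    domain D \<longrightarrow> D \<noteq> UNIV \<longrightarrow> uniformly_perfect C (sphere_boundary D) spherical_dist \<longrightarrow>
    (\<forall>f \<in> qc_identity_boundary K D. \<forall>x \<in> D. distance_ratio D x (finite_part f x) \<le> M)"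
proof -
  define N where "N = 1 + ring_const (DIM(real ^ 'n)) K * (4 + 6 * (25 * C)\<^sup>2)"
  have n2: "2 \<le> DIM(real ^ 'n)" using assms(1) by simp
  show ?thesis
  proof (intro exI[of _ "ln (1 + N)"] allI impI ballI)
    fix D :: "(real ^ 'n) set" and f x
    assume dom: "domain D" "D \<noteq> UNIV" and up: "uniformly_perfect C (sphere_boundary D) spherical_dist"
      and f: "f \<in> qc_identity_boundary K D" and x: "x \<in> D"
    define y where "y = finite_part f x"
    have D: "open D" "D \<noteq> {}" using dom by (auto simp: domain_def)
    have "0 \<le> K" using assms(3) by simp
    note est = dist_qc_identity_boundary_le[OF n2 assms(2) this D(1) up f x, folded y_def N_def]
    have "frontier D \<noteq> {}" using D dom frontier_eq_empty by blast
    \<comment> \<open>The distance to the closed frontier is attained, so the estimate is applied at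
      a nearest boundary point.\<close>
    have d: "0 < infdist p (frontier D) \<and> dist x y \<le> N * infdist p (frontier D)"
      if p: "p \<in> D" and le: "\<And>z. z \<in> frontier D \<Longrightarrow> dist x y \<le> N * dist p z" for p
    proof -
      obtain z where z: "z \<in> frontier D" "infdist p (frontier D) = dist p z"
        using infdist_attains_inf[OF frontier_closed \<open>frontier D \<noteq> {}\<close>] by blast
      moreover have "z \<noteq> p" using z p D(1) by (auto simp: frontier_def interior_open)
      ultimately show ?thesis using le by simp
    qed
    define m where "m = min (infdist x (frontier D)) (infdist y (frontier D))"
    have "0 < m" "dist x y \<le> N * m"
      using d[OF x est(1)] d[OF est(3) est(2)] by (auto simp: m_def min_def)
    then have "norm (x - y) / m \<le> N" by (simp add: divide_le_eq dist_norm)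
    moreover have "0 \<le> norm (x - y) / m" using \<open>0 < m\<close> by simp
    ultimately show "distance_ratio D x (finite_part f x) \<le> ln (1 + N)"
      unfolding distance_ratio_def y_def[symmetric] m_def[symmetric] by (intro ln_mono) auto
  qed
qed

end
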